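(* Let $(U_t,V_t)_{t\in\mathbb{Z}^+}$ be a Markov chain on the strip $\mathcal{A}\times\mathbb{Z}$, where $\mathcal{A} = \{0,1,\ldots,k-1\}$ for some $k \in \mathbb{N}$ or $\mathcal{A}=\mathbb{Z}^+$, with transition probabilities $$\mathbb{P} [ (U_{t+1}, V_{t+1} ) = (\ell', x + d) \mid U_t =\ell, V_t =x ] = \phi ( \ell, \ell'; d)$$ not depending on $x$, and suppose that the induced Markov chain $(U_t)$ on $\mathcal{A}$ is irreducible and null-recurrent, and that, for some $\gamma \in (0,1)$, $$\lim_{t\to \infty} \frac{\log \mathbb{P} [ \nu > t]}{\log t} = - \gamma .$$ Suppose that there exist $\alpha, \beta \in (0,1)$, $\delta >0$, and $C < \infty$ such that (i) $M_0^+ (\alpha) + M_0^- (\alpha) \leq C$; (ii) uniformly for all $\ell \in\mathcal{A}$ with $\ell\neq 0$, $$\lim_{x \to \infty} \frac{ \log T_\ell^- (x)}{\log x} = - \beta ;$$ and (iii) $M_\ell^+ (\beta + \delta) \leq C$ for all $\ell\in\mathcal{A}$ with $\ell \neq 0$. Then if $\alpha > \gamma \beta$, $V_t \to -\infty$ a.s. as $t \to \infty$, and, moreover, $$\lim_{t \to \infty} \frac{ \log |V_t|}{\log t} = \frac{1}{\beta} \quad \text{a.s.}$$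
   Context: $\mathbb{Z}^+ = \{0,1,2,\ldots\}$, $\mathbb{N}=\{1,2,\ldots\}$. For real $x$, $x^+ := x \mathbf{1}\{x>0\}$ and $x^- := -x\mathbf{1}\{x<0\}$. Because the transition probabilities depend only on $\ell,\ell',d$, the projection $(U_t)$ is itself a Markov chain on $\mathcal{A}$, with transition probabilities $q_{\ell,\ell'} = \sum_{d\in\mathbb{Z}}\phi(\ell,\ell';d)$ (the induced chain). $\nu := \min \{ t \in \mathbb{N} : U_t = 0 \}$ is the time of first return to the $0$-line, and its law $\mathbb{P}[\nu > t]$ is taken with $U_0=0$. For $x \geq 0$, $\ell\in\mathcal{A}$ and $\beta>0$, $$T_\ell^\pm (x) := \mathbb{P} [ (V_{t+1} - V_t)^\pm > x \mid U_t = \ell, V_t = z ], \qquad M_\ell ^\pm (\beta ) := \mathbb{E} [ ( (V_{t+1} - V_t)^\pm )^\beta \mid U_t = \ell, V_t = z ],$$ which do not depend on $z$ or $t$. *)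

theory Defs
  imports "HOL-Probability.Probability"
begin

definition pos_part :: "real \<Rightarrow> real" where
  "pos_part x = x * indicator {y. y > 0} x"

definition neg_part :: "real \<Rightarrow> real" where
  "neg_part x = - x * indicator {y. y < 0} x"

text \<open>
  A process \<open>X\<close> on a probability space \<open>M\<close> is a time-homogeneous Markov chain with (countable)
  state space \<open>S\<close> and transition kernel \<open>K\<close>; the initial distribution is arbitrary.
\<close>

definition markov_chain ::
    "'w measure \<Rightarrow> 's set \<Rightarrow> ('s \<Rightarrow> 's pmf) \<Rightarrow> (nat \<Rightarrow> 'w \<Rightarrow> 's) \<Rightarrow> bool" where
  "markov_chain M S K X \<longleftrightarrow>
     prob_space M \<and>
     (\<forall>t. X t \<in> measurable M (count_space S)) \<and>
     (\<forall>t y z. \<P>(\<omega> in M. \<forall>s\<le>t. X s \<omega> = y s) > 0 \<longrightarrow>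
        \<P>(\<omega> in M. X (Suc t) \<omega> = z \<bar> \<forall>s\<le>t. X s \<omega> = y s) = pmf (K (y t)) z)"


text \<open>
  The law, on path space, of the chain with kernel \<open>K\<close> started at \<open>x\<close>, obtained from the
  Ionescu-Tulcea theorem; \<open>markov_chain_markov_law\<close> below justifies the construction.
\<close>

definition markov_step :: "('s \<Rightarrow> 's pmf) \<Rightarrow> 's \<Rightarrow> nat \<Rightarrow> (nat \<Rightarrow> 's) \<Rightarrow> 's measure" where
  "markov_step K x i \<omega> =
     (case i of 0 \<Rightarrow> measure_pmf (return_pmf x) | Suc j \<Rightarrow> measure_pmf (K (\<omega> j)))"

definition markov_law :: "('s \<Rightarrow> 's pmf) \<Rightarrow> 's \<Rightarrow> (nat \<Rightarrow> 's) measure" where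
  "markov_law K x =
     projective_family.lim UNIV
       (Ionescu_Tulcea.CI (markov_step K x) (\<lambda>_. count_space UNIV))
       (\<lambda>_. count_space UNIV)"

definition return_time :: "'s \<Rightarrow> (nat \<Rightarrow> 's) \<Rightarrow> enat" where
  "return_time x \<omega> = (INF t\<in>{t. 1 \<le> t \<and> \<omega> t = x}. enat t)"

definition irreducible_chain :: "'s set \<Rightarrow> ('s \<Rightarrow> 's pmf) \<Rightarrow> bool" where
  "irreducible_chain S K \<longleftrightarrow>
     (\<forall>x\<in>S. \<forall>y\<in>S. \<exists>n. \<P>(\<omega> in markov_law K x. \<omega> n = y) > 0)"

definition null_recurrent_chain :: "'s set \<Rightarrow> ('s \<Rightarrow> 's pmf) \<Rightarrow> bool" where
  "null_recurrent_chain S K \<longleftrightarrow>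
     (\<forall>x\<in>S. (AE \<omega> in markov_law K x. return_time x \<omega> < \<infinity>) \<and>
            (\<integral>\<^sup>+\<omega>. ennreal_of_enat (return_time x \<omega>) \<partial>markov_law K x) = \<infinity>)"


text \<open>
  The transition probabilities \<open>\<phi>(l, l'; d)\<close> are encoded by the pmf-valued map
  \<open>\<phi> :: nat \<Rightarrow> (nat \<times> int) pmf\<close> with \<open>\<phi>(l, l'; d) = pmf (\<phi> l) (l', d)\<close>: the joint law of the new
  line and of the vertical increment, given that the chain is on line \<open>l\<close>.
  Values \<open>\<phi> l\<close> for \<open>l \<notin> A\<close> are irrelevant.
\<close>

definition line_set :: "nat set \<Rightarrow> bool" where
  "line_set A \<longleftrightarrow> (\<exists>k\<ge>1. A = {..<k}) \<or> A = UNIV"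

definition strip_transitions :: "nat set \<Rightarrow> (nat \<Rightarrow> (nat \<times> int) pmf) \<Rightarrow> bool" where
  "strip_transitions A \<phi> \<longleftrightarrow> (\<forall>l\<in>A. set_pmf (\<phi> l) \<subseteq> A \<times> UNIV)"

definition strip_kernel :: "(nat \<Rightarrow> (nat \<times> int) pmf) \<Rightarrow> nat \<times> int \<Rightarrow> (nat \<times> int) pmf" where
  "strip_kernel \<phi> = (\<lambda>(l, x). map_pmf (\<lambda>(l', d). (l', x + d)) (\<phi> l))"

definition induced_kernel :: "(nat \<Rightarrow> (nat \<times> int) pmf) \<Rightarrow> nat \<Rightarrow> nat pmf" where
  "induced_kernel \<phi> l = map_pmf fst (\<phi> l)"

text \<open>
  Tails and moments of the increment \<open>V (t + 1) - V t\<close> given \<open>U t = l\<close> and \<open>V t = z\<close>; the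
  conditional law of the increment is the second marginal of \<open>\<phi> l\<close>, whatever \<open>t\<close> and \<open>z\<close>.
\<close>

definition T_neg :: "(nat \<Rightarrow> (nat \<times> int) pmf) \<Rightarrow> nat \<Rightarrow> real \<Rightarrow> real" where
  "T_neg \<phi> l x = \<P>((l', d) in measure_pmf (\<phi> l). neg_part (of_int d) > x)"

definition M_pos :: "(nat \<Rightarrow> (nat \<times> int) pmf) \<Rightarrow> nat \<Rightarrow> real \<Rightarrow> ennreal" where
  "M_pos \<phi> l b = (\<integral>\<^sup>+(l', d). ennreal (pos_part (of_int d) powr b) \<partial>measure_pmf (\<phi> l))"

definition M_neg :: "(nat \<Rightarrow> (nat \<times> int) pmf) \<Rightarrow> nat \<Rightarrow> real \<Rightarrow> ennreal" where
  "M_neg \<phi> l b = (\<integral>\<^sup>+(l', d). ennreal (neg_part (of_int d) powr b) \<partial>measure_pmf (\<phi> l))"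

lemma pmf_strip_kernel: "pmf (strip_kernel \<phi> (l, x)) (l', x + d) = pmf (\<phi> l) (l', d)"
proof -
  have "inj (\<lambda>(l', d::int). (l'::nat, x + d))"
    by (auto simp: inj_on_def)
  from pmf_map_inj'[OF this, of "\<phi> l" "(l', d)"] show ?thesis
    by (simp add: strip_kernel_def)
qed

lemma pmf_induced_kernel: "pmf (induced_kernel \<phi> l) l' = infsetsum (\<lambda>d. pmf (\<phi> l) (l', d)) UNIV"
proof -
  have "pmf (induced_kernel \<phi> l) l' = measure_pmf.prob (\<phi> l) (fst -` {l'})"
    by (simp add: induced_kernel_def pmf_map)
  also have "fst -` {l'} = Pair l' ` (UNIV :: int set)"
    by auto
  also have "measure_pmf.prob (\<phi> l) \<dots> = infsetsum (pmf (\<phi> l)) (Pair l' ` UNIV)"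
    by (rule measure_pmf_conv_infsetsum)
  also have "\<dots> = infsetsum (\<lambda>d. pmf (\<phi> l) (l', d)) UNIV"
    by (rule infsetsum_reindex) (auto simp: inj_on_def)
  finally show ?thesis .
qed

lemma Ionescu_Tulcea_markov_step:
  fixes K :: "'s :: countable \<Rightarrow> 's pmf"
  shows "Ionescu_Tulcea (markov_step K x) (\<lambda>_. count_space UNIV)"
proof (rule Ionescu_Tulcea.intro)
  fix i :: nat
  show "markov_step K x i \<in> measurable (PiM {0..<i} (\<lambda>_. count_space UNIV))
          (subprob_algebra (count_space UNIV))"
  proof (cases i)
    case 0
    then show ?thesis
      by (simp add: markov_step_def[abs_def] measure_pmf_in_subprob_algebra)
  next
    case (Suc j)
    have "(\<lambda>\<omega>. \<omega> j) \<in> measurable (PiM {0..<i} (\<lambda>_. count_space UNIV)) (count_space (UNIV :: 's set))"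
      using Suc by (intro measurable_component_singleton) auto
    moreover have "(\<lambda>s. measure_pmf (K s)) \<in> measurable (count_space UNIV) (subprob_algebra (count_space UNIV))"
      by (simp add: measure_pmf_in_subprob_algebra)
    ultimately have "(\<lambda>\<omega>. measure_pmf (K (\<omega> j))) \<in>
        measurable (PiM {0..<i} (\<lambda>_. count_space UNIV)) (subprob_algebra (count_space UNIV))"
      by (rule measurable_compose)
    then show ?thesis
      by (simp add: markov_step_def[abs_def] Suc)
  qed
next
  show "prob_space (markov_step K x i \<omega>)" for i and \<omega> :: "nat \<Rightarrow> 's"
    by (cases i) (simp_all add: markov_step_def prob_space_measure_pmf)
qed

lemma
  fixes K :: "'s :: countable \<Rightarrow> 's pmf"
  shows prob_space_markov_law: "prob_space (markov_law K x)"
    and sets_markov_law: "sets (markov_law K x) = sets (PiM UNIV (\<lambda>_. count_space UNIV))"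
    and space_markov_law: "space (markov_law K x) = UNIV"
proof -
  interpret IT: Ionescu_Tulcea "markov_step K x" "\<lambda>_. count_space UNIV"
    by (rule Ionescu_Tulcea_markov_step)
  show s: "sets (markov_law K x) = sets (PiM UNIV (\<lambda>_. count_space UNIV))"
    by (simp add: markov_law_def)
  show sp: "space (markov_law K x) = UNIV"
    using sets_eq_imp_space_eq[OF s] by (simp add: space_PiM)
  interpret C: prob_space "IT.CI {}"
    by (rule IT.PF.prob_space_P) auto
  have "emeasure (markov_law K x) (IT.PF.emb UNIV {} (space (PiM {} (\<lambda>_. count_space UNIV)))) =
        emeasure (IT.CI {}) (space (PiM {} (\<lambda>_. count_space UNIV)))"
    unfolding markov_law_def by (rule IT.lim) auto
  also have "space (PiM {} (\<lambda>_. count_space UNIV)) = space (IT.CI {})"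
    by (simp add: IT.CI_def)
  also have "IT.PF.emb UNIV {} (space (IT.CI {})) = UNIV"
  proof -
    have r: "restrict \<omega> {} = (\<lambda>_. undefined)" for \<omega> :: "nat \<Rightarrow> 's"
      by (rule ext) simp
    show ?thesis
      unfolding prod_emb_def by (simp add: space_PiM IT.CI_def r)
  qed
  finally have "emeasure (markov_law K x) (space (markov_law K x)) = 1"
    unfolding sp C.emeasure_space_1 .
  then show "prob_space (markov_law K x)"
    by (rule prob_spaceI)
qed

lemma measure_markov_law_path:
  fixes K :: "'s :: countable \<Rightarrow> 's pmf"
  shows "\<P>(\<omega> in markov_law K x. \<forall>s\<le>t. \<omega> s = y s) =
           (if y 0 = x then (\<Prod>s<t. pmf (K (y s)) (y (Suc s))) else 0)"
proof -
  let ?M = "\<lambda>_ :: nat. count_space (UNIV :: 's set)"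
  interpret IT: Ionescu_Tulcea "markov_step K x" "?M"
    by (rule Ionescu_Tulcea_markov_step)
  define X where "X n = (PiE {0..<n} (\<lambda>s. {y s}))" for n
  have sX[measurable]: "X n \<in> sets (PiM {0..<n} ?M)" for n
    unfolding X_def by (intro sets_PiM_I_finite) auto
  define w where "w n = (case n of 0 \<Rightarrow> indicator {y 0} x | Suc j \<Rightarrow> pmf (K (y j)) (y (Suc j)))" for n
  have w_nonneg: "0 \<le> w n" for n
    by (cases n) (simp_all add: w_def)
  have C: "emeasure (IT.C 0 n (\<lambda>_. undefined)) (X n) = ennreal (\<Prod>s<n. w s)" for n
  proof (induction n)
    case 0
    have "X 0 \<in> sets (PiM {} ?M)"
      using sX[of 0] by simp
    moreover have "(\<lambda>_. undefined) \<in> X 0"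
      by (simp add: X_def)
    ultimately show ?case
      by simp
  next
    case (Suc n)
    let ?u = "\<lambda>_. undefined :: 's"
    have u: "?u \<in> space (PiM {0..<0} ?M)"
      by (simp add: space_PiM)
    have nn: "fun_upd \<omega> n z \<in> X (Suc n) \<longleftrightarrow> \<omega> \<in> X n \<and> z = y n"
      if "\<omega> \<in> space (PiM {0..<n} ?M)" for \<omega> z
    proof
      assume *: "fun_upd \<omega> n z \<in> X (Suc n)"
      have "(fun_upd \<omega> n z) j = y j" if "j < Suc n" for j
        using * that by (simp add: X_def PiE_iff)
      then have "z = y n" and "\<And>j. j < n \<Longrightarrow> \<omega> j = y j"
        by (force, metis fun_upd_other less_SucI less_irrefl)
      with that show "\<omega> \<in> X n \<and> z = y n"
        by (simp add: X_def PiE_iff space_PiM)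
    next
      assume "\<omega> \<in> X n \<and> z = y n"
      then show "fun_upd \<omega> n z \<in> X (Suc n)"
        by (simp add: X_def PiE_iff extensional_def)
    qed
    have "emeasure (IT.C 0 n ?u \<bind> IT.eP n) (X (Suc n)) =
        (\<integral>\<^sup>+\<omega>. emeasure (IT.eP n \<omega>) (X (Suc n)) \<partial>IT.C 0 n ?u)"
    proof (rule emeasure_bind)
      show "space (IT.C 0 n ?u) \<noteq> {}"
        by (rule prob_space.not_empty[OF IT.prob_space_C[OF u]])
      have "sets (IT.C 0 n ?u) = sets (PiM {0..<n} ?M)"
        using IT.sets_C[OF u, of n] by simp
      then show "IT.eP n \<in> measurable (IT.C 0 n ?u) (subprob_algebra (PiM {0..<Suc n} ?M))"
        using IT.measurable_eP[of n] measurable_cong_sets by blast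
    qed (rule sX)
    then have "emeasure (IT.C 0 (Suc n) ?u) (X (Suc n)) =
        (\<integral>\<^sup>+\<omega>. emeasure (IT.eP n \<omega>) (X (Suc n)) \<partial>IT.C 0 n ?u)"
      by simp
    also have "\<dots> = (\<integral>\<^sup>+\<omega>. ennreal (w n) * indicator (X n) \<omega> \<partial>IT.C 0 n ?u)"
    proof (rule nn_integral_cong)
      fix \<omega> assume "\<omega> \<in> space (IT.C 0 n ?u)"
      then have \<omega>: "\<omega> \<in> space (PiM {0..<n} ?M)"
        using IT.space_C[OF u, of n] by simp
      have "emeasure (IT.eP n \<omega>) (X (Suc n)) = emeasure (markov_step K x n \<omega>) {z. \<omega> \<in> X n \<and> z = y n}"
        using nn[OF \<omega>] by (subst IT.emeasure_eP[OF \<omega> sX]) (auto intro!: arg_cong2[where f=emeasure])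
      also have "\<dots> = ennreal (w n) * indicator (X n) \<omega>"
      proof (cases "\<omega> \<in> X n")
        case True
        then have "j < n \<Longrightarrow> \<omega> j = y j" for j
          by (auto simp: X_def PiE_iff)
        with True show ?thesis
          by (auto simp: markov_step_def w_def emeasure_pmf_single split: nat.split)
      qed simp
      finally show "emeasure (IT.eP n \<omega>) (X (Suc n)) = ennreal (w n) * indicator (X n) \<omega>" .
    qed
    also have "\<dots> = ennreal (w n) * emeasure (IT.C 0 n ?u) (X n)"
      using u by (intro nn_integral_cmult_indicator) (simp add: IT.sets_C)
    also have "\<dots> = ennreal (\<Prod>s<Suc n. w s)"
      by (simp add: Suc.IH ennreal_mult' w_nonneg prod_nonneg mult.commute)
    finally show ?case .
  qed
  have "{\<omega> \<in> space (markov_law K x). \<forall>s\<le>t. \<omega> s = y s} = IT.PF.emb UNIV {0..<Suc t} (X (Suc t))"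
    by (auto simp: space_markov_law prod_emb_def space_PiM X_def PiE_iff less_Suc_eq_le)
  then have "emeasure (markov_law K x) {\<omega> \<in> space (markov_law K x). \<forall>s\<le>t. \<omega> s = y s} =
      emeasure (IT.CI {0..<Suc t}) (X (Suc t))"
    unfolding markov_law_def by (simp add: IT.lim del: atLeastLessThan_iff)
  also have "\<dots> = emeasure (IT.C 0 (Suc t) (\<lambda>_. undefined)) (X (Suc t))"
  proof -
    have "IT.PF.emb {0..<Suc t} {0..<Suc t} (X (Suc t)) = X (Suc t)"
      by (rule prod_emb_id) (auto simp: X_def)
    then show ?thesis
      by (subst IT.emeasure_CI[of _ "Suc t"]) (simp_all del: IT.C.simps)
  qed
  also have "\<dots> = ennreal (\<Prod>s<Suc t. w s)"
    by (rule C)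
  finally have "\<P>(\<omega> in markov_law K x. \<forall>s\<le>t. \<omega> s = y s) = (\<Prod>s<Suc t. w s)"
    by (intro measure_eq_emeasure_eq_ennreal prod_nonneg w_nonneg)
  also have "\<dots> = w 0 * (\<Prod>s<t. w (Suc s))"
    by (rule prod.lessThan_Suc_shift)
  also have "\<dots> = (if y 0 = x then (\<Prod>s<t. pmf (K (y s)) (y (Suc s))) else 0)"
    by (simp add: w_def)
  finally show ?thesis .
qed

lemma markov_chain_markov_law:
  fixes K :: "'s :: countable \<Rightarrow> 's pmf"
  shows "markov_chain (markov_law K x) UNIV K (\<lambda>t \<omega>. \<omega> t)"
    and "AE \<omega> in markov_law K x. \<omega> 0 = x"
proof -
  interpret prob_space "markov_law K x"
    by (rule prob_space_markov_law)
  show "markov_chain (markov_law K x) UNIV K (\<lambda>t \<omega>. \<omega> t)"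
    unfolding markov_chain_def
  proof (intro conjI allI impI)
    show "prob_space (markov_law K x)"
      by (rule prob_space_markov_law)
    show "(\<lambda>\<omega>. \<omega> t) \<in> measurable (markov_law K x) (count_space UNIV)" for t
      by (subst measurable_cong_sets[OF sets_markov_law refl]) (rule measurable_component_singleton, simp)
    fix t :: nat and y :: "nat \<Rightarrow> 's" and z
    assume pos: "\<P>(\<omega> in markov_law K x. \<forall>s\<le>t. \<omega> s = y s) > 0"
    let ?y = "y(Suc t := z)"
    have "\<P>(\<omega> in markov_law K x. \<omega> (Suc t) = z \<and> (\<forall>s\<le>t. \<omega> s = y s)) =
        \<P>(\<omega> in markov_law K x. \<forall>s\<le>Suc t. \<omega> s = ?y s)"
      by (rule arg_cong2[where f=measure]) (auto simp: le_Suc_eq)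
    also have "\<dots> = \<P>(\<omega> in markov_law K x. \<forall>s\<le>t. \<omega> s = y s) * pmf (K (y t)) z"
      unfolding measure_markov_law_path by (auto intro!: prod.cong)
    finally show "\<P>(\<omega> in markov_law K x. \<omega> (Suc t) = z \<bar> \<forall>s\<le>t. \<omega> s = y s) = pmf (K (y t)) z"
      using pos by (simp add: cond_prob_def)
  qed
  have "\<P>(\<omega> in markov_law K x. \<omega> 0 = x) = 1"
    using measure_markov_law_path[of K x 0 "\<lambda>_. x"] by simp
  then show "AE \<omega> in markov_law K x. \<omega> 0 = x"
    using AE_prob_1[of "{\<omega> \<in> space (markov_law K x). \<omega> 0 = x}"] by simp
qed

end

theory Submission
  imports Defs "HOL-Real_Asymp.Real_Asymp"
begin

text \<open>
  Split the vertical displacement according to the line from which a step is made and to its sign: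
  \<open>V t = V 0 + P - G + Z\<close>, where \<open>G\<close> and \<open>P\<close> are the sums of the downward and upward parts of the
  steps from lines other than 0, and \<open>Z\<close> is the sum of the steps from the line 0, up to time \<open>t\<close>. The
  theorem holds because \<open>G\<close> has growth exponent exactly \<open>1 / \<beta>\<close>, while \<open>P\<close> and \<open>Z\<close> are of polynomially
  smaller order.

  All upper bounds come from one principle. All relevant moments have order \<open>a \<le> 1\<close>, and
  \<open>x powr a\<close> is then subadditive, so the expectation of the \<open>a\<close>-th power of a sum is at most the sum of
  the \<open>a\<close>-th moments; a Borel-Cantelli argument along powers of two
  (\<open>AE_eventually_sum_le_powr\<close>) makes this an almost sure bound. For \<open>P\<close> this gives exponents above
  \<open>1 / (\<beta> + \<delta>)\<close>, or above 1 if \<open>\<beta> + \<delta> > 1\<close>. For \<open>G\<close> it gives exponents above \<open>1 / \<beta>\<close>, because the uniform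
  tail bound yields uniform moments of all orders below \<open>\<beta>\<close>
  (\<open>nn_integral_powr_le_of_dyadic_tail\<close>). For \<open>Z\<close> the number of summands is the number of visits to
  the line 0, and the exponents are those above \<open>\<gamma> / \<alpha>\<close>, which is below \<open>1 / \<beta>\<close> by hypothesis.

  The number of visits is controlled through its mean. The times \<open>s \<le> t\<close> compete for being the last
  visit to 0 up to time \<open>t\<close>, and each visit is the last one with conditional probability at least
  the probability \<open>r\<close> that \<open>\<nu> > t\<close>. Hence \<open>r\<close> times the expected number of visits is at most 1
  (\<open>expected_visits_le\<close>), and the mean is at most about \<open>t powr \<gamma>\<close>.

  The lower bound for \<open>G\<close> uses a single large jump. As \<open>\<gamma> < 1\<close>, most of the first \<open>t\<close> steps start away
  from the line 0, and each of them is a downward jump beyond \<open>t powr \<kappa>\<close> with conditional probability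
  about \<open>t powr (- \<kappa> * \<beta>)\<close>. For \<open>\<kappa> < 1 / \<beta>\<close> the probability that all of them fail is
  stretched-exponentially small (\<open>prob_no_jump_le\<close>), so almost surely such a jump occurs for all large
  \<open>t\<close> (\<open>AE_eventually_powr_le_neg_sum\<close>).
\<close>

section \<open>The Markov property at a fixed time\<close>

lemma measurable_markov_chain:
  assumes "markov_chain M S K X"
  shows "X t \<in> measurable M (count_space UNIV)"
proof -
  have "X t \<in> measurable M (count_space S)"
    using assms by (simp add: markov_chain_def)
  then show ?thesis
    by (rule measurable_compose) simp
qed

text \<open>
  Reduces expectations to sums over point masses, the only probabilities about which the
  definition of a Markov chain speaks.
\<close>
lemma nn_integral_countable_valued:
  fixes f :: "'s::countable \<Rightarrow> ennreal"
  assumes [measurable]: "Y \<in> measurable M (count_space UNIV)"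
  shows "(\<integral>\<^sup>+\<omega>. f (Y \<omega>) \<partial>M) =
    (\<integral>\<^sup>+y. f y * emeasure M {\<omega> \<in> space M. Y \<omega> = y} \<partial>count_space UNIV)"
proof -
  have "(\<integral>\<^sup>+\<omega>. f (Y \<omega>) \<partial>M) =
      (\<integral>\<^sup>+\<omega>. (\<integral>\<^sup>+y. f y * indicator {\<omega> \<in> space M. Y \<omega> = y} \<omega> \<partial>count_space UNIV) \<partial>M)"
  proof (rule nn_integral_cong)
    fix \<omega> assume "\<omega> \<in> space M"
    then have "f y * indicator {\<omega> \<in> space M. Y \<omega> = y} \<omega> = f (Y \<omega>) * indicator {Y \<omega>} y" for y
      by (auto simp: indicator_def)
    then show "f (Y \<omega>) = (\<integral>\<^sup>+y. f y * indicator {\<omega> \<in> space M. Y \<omega> = y} \<omega> \<partial>count_space UNIV)"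
      by (simp add: nn_integral_cmult_indicator)
  qed
  also have "\<dots> = (\<integral>\<^sup>+y. (\<integral>\<^sup>+\<omega>. f y * indicator {\<omega> \<in> space M. Y \<omega> = y} \<omega> \<partial>M) \<partial>count_space UNIV)"
    by (rule nn_integral_count_space_nn_integral) auto
  also have "\<dots> = (\<integral>\<^sup>+y. f y * emeasure M {\<omega> \<in> space M. Y \<omega> = y} \<partial>count_space UNIV)"
    by (simp add: nn_integral_cmult_indicator)
  finally show ?thesis .
qed

text \<open>
  The working form of the Markov property: given the past \<open>X 0, \<dots>, X t\<close>, average over the next state
  with the kernel. The past enters through an arbitrary function \<open>F\<close> of the path that looks at times
  up to \<open>t\<close> only. The list \<open>H\<close> of the first \<open>t + 1\<close> states takes countably many values, so both sides
  are sums over pairs (history, next state), and the definition of a Markov chain factorises the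
  probability of each pair; histories of probability zero contribute nothing to either side.
\<close>
lemma markov_property:
  fixes X :: "nat \<Rightarrow> 'w \<Rightarrow> 's::countable" and F :: "(nat \<Rightarrow> 's) \<Rightarrow> ennreal"
  assumes mc: "markov_chain M S K X"
    and F: "\<And>y y'. (\<And>s. s \<le> t \<Longrightarrow> y s = y' s) \<Longrightarrow> F y = F y'"
  shows "(\<integral>\<^sup>+\<omega>. F (\<lambda>s. X s \<omega>) * g (X t \<omega>) (X (Suc t) \<omega>) \<partial>M) =
    (\<integral>\<^sup>+\<omega>. F (\<lambda>s. X s \<omega>) * (\<integral>\<^sup>+z. g (X t \<omega>) z \<partial>measure_pmf (K (X t \<omega>))) \<partial>M)"
proof -
  interpret prob_space M using mc by (simp add: markov_chain_def)
  note [measurable] = measurable_markov_chain[OF mc]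
  define H where "H \<omega> = map (\<lambda>s. X s \<omega>) [0..<Suc t]" for \<omega>
  have H_eq: "H \<omega> = h \<longleftrightarrow> length h = Suc t \<and> (\<forall>s\<le>t. X s \<omega> = h ! s)" for \<omega> h
    by (auto simp: H_def list_eq_iff_nth_eq less_Suc_eq_le simp del: upt_Suc)
  have H_nth: "H \<omega> ! s = X s \<omega>" if "s \<le> t" for \<omega> s
    using that by (simp add: H_def del: upt_Suc)
  have F_H: "F (\<lambda>s. X s \<omega>) = F (nth (H \<omega>))" for \<omega>
    by (rule F) (simp add: H_nth)
  have H_sets[measurable]: "{\<omega> \<in> space M. H \<omega> = h} \<in> sets M" for h
    unfolding H_eq by measurable
  have mH[measurable]: "H \<in> measurable M (count_space UNIV)"
    by (rule measurable_count_space_eq2_countable[THEN iffD2])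
       (auto simp: vimage_def Int_def conj_commute[of _ "_ \<in> space M"])
  have joint: "emeasure M {\<omega> \<in> space M. (H \<omega>, X (Suc t) \<omega>) = (h, x)} =
      emeasure M {\<omega> \<in> space M. H \<omega> = h} * ennreal (pmf (K (h ! t)) x)" for h x
  proof (cases "length h = Suc t \<and> prob {\<omega> \<in> space M. H \<omega> = h} > 0")
    case True
    have eq: "{\<omega> \<in> space M. H \<omega> = h} = {\<omega> \<in> space M. \<forall>s\<le>t. X s \<omega> = h ! s}"
      using True by (simp add: H_eq)
    have "\<P>(\<omega> in M. X (Suc t) \<omega> = x \<bar> \<forall>s\<le>t. X s \<omega> = h ! s) = pmf (K (h ! t)) x"
      using mc True unfolding markov_chain_def eq by blast
    then have "prob {\<omega> \<in> space M. X (Suc t) \<omega> = x \<and> (\<forall>s\<le>t. X s \<omega> = h ! s)} =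
        prob {\<omega> \<in> space M. H \<omega> = h} * pmf (K (h ! t)) x"
      using True unfolding cond_prob_def eq by (simp add: field_simps)
    moreover have "{\<omega> \<in> space M. (H \<omega>, X (Suc t) \<omega>) = (h, x)} =
        {\<omega> \<in> space M. X (Suc t) \<omega> = x \<and> (\<forall>s\<le>t. X s \<omega> = h ! s)}"
      using True by (auto simp: H_eq)
    ultimately show ?thesis
      by (simp add: emeasure_eq_measure ennreal_mult')
  next
    case False
    have "prob {\<omega> \<in> space M. H \<omega> = h} = 0"
    proof (cases "length h = Suc t")
      case True
      with False show ?thesis by (simp add: zero_less_measure_iff)
    qed (simp add: H_eq)
    then have null: "emeasure M {\<omega> \<in> space M. H \<omega> = h} = 0"
      by (simp add: emeasure_eq_measure)
    have "emeasure M {\<omega> \<in> space M. (H \<omega>, X (Suc t) \<omega>) = (h, x)} \<le>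
        emeasure M {\<omega> \<in> space M. H \<omega> = h}"
      by (rule emeasure_mono) auto
    with null show ?thesis by simp
  qed
  have "(\<integral>\<^sup>+\<omega>. F (\<lambda>s. X s \<omega>) * g (X t \<omega>) (X (Suc t) \<omega>) \<partial>M) =
      (\<integral>\<^sup>+\<omega>. (case (H \<omega>, X (Suc t) \<omega>) of (h, x) \<Rightarrow> F (nth h) * g (h ! t) x) \<partial>M)"
    by (simp add: F_H H_nth)
  also have "\<dots> = (\<integral>\<^sup>+z. (case z of (h, x) \<Rightarrow> F (nth h) * g (h ! t) x) *
      emeasure M {\<omega> \<in> space M. (H \<omega>, X (Suc t) \<omega>) = z} \<partial>count_space UNIV)"
    by (rule nn_integral_countable_valued)
       (auto intro!: measurable_Pair simp: pair_measure_countable[symmetric] simp del: pair_measure_countable)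
  also have "\<dots> = (\<integral>\<^sup>+h. (\<integral>\<^sup>+x. F (nth h) * g (h ! t) x *
      emeasure M {\<omega> \<in> space M. (H \<omega>, X (Suc t) \<omega>) = (h, x)} \<partial>count_space UNIV) \<partial>count_space UNIV)"
    by (subst nn_integral_fst_count_space[symmetric]) simp
  also have "\<dots> = (\<integral>\<^sup>+h. F (nth h) * (\<integral>\<^sup>+x. g (h ! t) x \<partial>measure_pmf (K (h ! t))) *
      emeasure M {\<omega> \<in> space M. H \<omega> = h} \<partial>count_space UNIV)"
    unfolding joint
    by (intro nn_integral_cong)
       (simp add: nn_integral_measure_pmf nn_integral_cmult[symmetric] nn_integral_multc[symmetric] mult_ac)
  also have "\<dots> = (\<integral>\<^sup>+\<omega>. F (nth (H \<omega>)) *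
      (\<integral>\<^sup>+x. g (H \<omega> ! t) x \<partial>measure_pmf (K (H \<omega> ! t))) \<partial>M)"
    by (rule nn_integral_countable_valued[symmetric]) simp
  also have "\<dots> = (\<integral>\<^sup>+\<omega>. F (\<lambda>s. X s \<omega>) * (\<integral>\<^sup>+z. g (X t \<omega>) z \<partial>measure_pmf (K (X t \<omega>))) \<partial>M)"
    by (simp add: F_H H_nth)
  finally show ?thesis .
qed

lemma markov_chain_space:
  assumes "markov_chain M S K X" "\<omega> \<in> space M"
  shows "X t \<omega> \<in> S"
proof -
  have "X t \<in> measurable M (count_space S)"
    using assms by (simp add: markov_chain_def)
  from measurable_space[OF this assms(2)] show ?thesis by simp
qed

lemma nn_integral_markov_step:
  fixes X :: "nat \<Rightarrow> 'w \<Rightarrow> 's::countable"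
  assumes mc: "markov_chain M S K X"
  shows "(\<integral>\<^sup>+\<omega>. g (X t \<omega>) (X (Suc t) \<omega>) \<partial>M) =
    (\<integral>\<^sup>+\<omega>. (\<integral>\<^sup>+z. g (X t \<omega>) z \<partial>measure_pmf (K (X t \<omega>))) \<partial>M)"
  using markov_property[OF mc, of t "\<lambda>_. 1" g] by simp

text \<open>
  The partial products form a supermartingale started at 1. With an exponential weight \<open>w\<close> this
  bounds the probability that an event keeps failing although every step gives it a chance.
\<close>
lemma nn_integral_multiplicative_le_1:
  fixes X :: "nat \<Rightarrow> 'w \<Rightarrow> 's::countable" and w :: "'s \<Rightarrow> 's \<Rightarrow> ennreal"
  assumes mc: "markov_chain M S K X"
    and w: "\<And>x. x \<in> S \<Longrightarrow> (\<integral>\<^sup>+z. w x z \<partial>measure_pmf (K x)) \<le> 1"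
  shows "(\<integral>\<^sup>+\<omega>. (\<Prod>s<t. w (X s \<omega>) (X (Suc s) \<omega>)) \<partial>M) \<le> 1"
proof (induction t)
  case 0
  interpret prob_space M using mc by (simp add: markov_chain_def)
  show ?case by (simp add: emeasure_space_1)
next
  case (Suc t)
  have "(\<integral>\<^sup>+\<omega>. (\<Prod>s<Suc t. w (X s \<omega>) (X (Suc s) \<omega>)) \<partial>M) =
      (\<integral>\<^sup>+\<omega>. (\<Prod>s<t. w (X s \<omega>) (X (Suc s) \<omega>)) *
        (\<integral>\<^sup>+z. w (X t \<omega>) z \<partial>measure_pmf (K (X t \<omega>))) \<partial>M)"
    using markov_property[OF mc, of t "\<lambda>y. \<Prod>s<t. w (y s) (y (Suc s))" w] by simp
  also have "\<dots> \<le> (\<integral>\<^sup>+\<omega>. (\<Prod>s<t. w (X s \<omega>) (X (Suc s) \<omega>)) * 1 \<partial>M)"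
    by (intro nn_integral_mono mult_left_mono w markov_chain_space[OF mc]) auto
  also have "\<dots> \<le> 1"
    using Suc.IH by simp
  finally show ?case .
qed

section \<open>Expected number of visits to a set\<close>

text \<open>
  The probability that the first \<open>n\<close> steps of the chain started at \<open>x\<close> all land in \<open>B\<close>. The recursion
  on the first step involves the kernel only, so it can be compared between the strip chain and the
  induced chain although these live on different probability spaces.
\<close>
primrec stay_prob :: "('s \<Rightarrow> 's pmf) \<Rightarrow> 's set \<Rightarrow> nat \<Rightarrow> 's \<Rightarrow> ennreal" where
  "stay_prob K B 0 x = 1"
| "stay_prob K B (Suc n) x = (\<integral>\<^sup>+z. indicator B z * stay_prob K B n z \<partial>measure_pmf (K x))"

lemma antimono_stay_prob: "m \<le> n \<Longrightarrow> stay_prob K B n x \<le> stay_prob K B m x"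
proof (rule lift_Suc_antimono_le[of "\<lambda>n. stay_prob K B n x"])
  show "stay_prob K B (Suc n) x \<le> stay_prob K B n x" for n
  proof (induction n arbitrary: x)
    case 0
    have "stay_prob K B (Suc 0) x \<le> (\<integral>\<^sup>+z. 1 \<partial>measure_pmf (K x))"
      unfolding stay_prob.simps by (intro nn_integral_mono) (auto simp: indicator_def)
    then show ?case by simp
  next
    case (Suc n)
    then show ?case
      by (subst (1 2) stay_prob.simps) (intro nn_integral_mono mult_left_mono, auto)
  qed
qed

text \<open>
  Links the recursion to an actual chain. Induction on \<open>n\<close> absorbs the first step after time \<open>t\<close> into
  the function of the past, which is why \<open>F\<close> has to be general.
\<close>
lemma nn_integral_stay:
  fixes X :: "nat \<Rightarrow> 'w \<Rightarrow> 's::countable" and F :: "(nat \<Rightarrow> 's) \<Rightarrow> ennreal"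
  assumes mc: "markov_chain M S K X"
    and F: "\<And>y y'. (\<And>s. s \<le> t \<Longrightarrow> y s = y' s) \<Longrightarrow> F y = F y'"
  shows "(\<integral>\<^sup>+\<omega>. F (\<lambda>s. X s \<omega>) * (\<Prod>j\<in>{t<..t+n}. indicator B (X j \<omega>)) \<partial>M) =
    (\<integral>\<^sup>+\<omega>. F (\<lambda>s. X s \<omega>) * stay_prob K B n (X t \<omega>) \<partial>M)"
  using F
proof (induction n arbitrary: t F)
  case 0
  show ?case by simp
next
  case (Suc n)
  have ivl: "{t<..t + Suc n} = insert (Suc t) {Suc t<..Suc t + n}"
    by auto
  have "(\<integral>\<^sup>+\<omega>. F (\<lambda>s. X s \<omega>) * (\<Prod>j\<in>{t<..t+Suc n}. indicator B (X j \<omega>)) \<partial>M) =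
      (\<integral>\<^sup>+\<omega>. (F (\<lambda>s. X s \<omega>) * indicator B (X (Suc t) \<omega>)) *
        (\<Prod>j\<in>{Suc t<..Suc t+n}. indicator B (X j \<omega>)) \<partial>M)"
    unfolding ivl by (subst prod.insert) (simp_all add: mult_ac)
  also have "\<dots> = (\<integral>\<^sup>+\<omega>. (F (\<lambda>s. X s \<omega>) * indicator B (X (Suc t) \<omega>)) *
      stay_prob K B n (X (Suc t) \<omega>) \<partial>M)"
  proof (rule Suc.IH[of "Suc t" "\<lambda>y. F y * indicator B (y (Suc t))"])
    fix y y' :: "nat \<Rightarrow> 's" assume *: "\<And>s. s \<le> Suc t \<Longrightarrow> y s = y' s"
    then have "F y = F y'" by (intro Suc.prems) simp
    with * show "F y * indicator B (y (Suc t)) = F y' * indicator B (y' (Suc t))" by simp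
  qed
  also have "\<dots> = (\<integral>\<^sup>+\<omega>. F (\<lambda>s. X s \<omega>) * stay_prob K B (Suc n) (X t \<omega>) \<partial>M)"
    using markov_property[where F=F and t=t, OF mc Suc.prems, where g="\<lambda>_ z. indicator B z * stay_prob K B n z"]
    by (simp add: mult_ac)
  finally show ?case .
qed

text \<open>
  The summand with index \<open>s\<close> is the indicator of \<open>s\<close> being the time of the last visit to \<open>D\<close> in
  \<open>{0..n}\<close>, and there is at most one such time.
\<close>
lemma last_visit_unique:
  fixes y :: "nat \<Rightarrow> 's"
  shows "(\<Sum>s\<le>n. indicator D (y s) * (\<Prod>j\<in>{s<..n}. indicator (- D) (y j))) \<le> (1::ennreal)"
proof (induction n)
  case 0
  then show ?case unfolding atMost_0 by (subst sum.insert) (auto simp: indicator_def)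
next
  case (Suc n)
  have ivl: "{s<..Suc n} = insert (Suc n) {s<..n}" if "s \<le> n" for s
    using that by auto
  have "(\<Sum>s\<le>n. indicator D (y s) * (\<Prod>j\<in>{s<..Suc n}. indicator (- D) (y j))) =
     indicator (- D) (y (Suc n)) *
     (\<Sum>s\<le>n. indicator D (y s) * (\<Prod>j\<in>{s<..n}. indicator (- D) (y j)) :: ennreal)"
    unfolding sum_distrib_left
  proof (rule sum.cong[OF refl])
    fix s assume "s \<in> {..n}"
    then have "s \<le> n" by simp
    show "indicator D (y s) * (\<Prod>j\<in>{s<..Suc n}. indicator (- D) (y j)) =
        indicator (- D) (y (Suc n)) *
        (indicator D (y s) * (\<Prod>j\<in>{s<..n}. indicator (- D) (y j)) :: ennreal)"
      unfolding ivl[OF \<open>s \<le> n\<close>] by (subst prod.insert) (simp_all only: mult_ac, simp_all)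
  qed
  then show ?case
    using Suc by (simp add: indicator_def)
qed

text \<open>
  Last-exit decomposition. A visit at time \<open>s\<close> is the last one up to time \<open>n\<close> with conditional
  probability at least \<open>r\<close>, since avoiding \<open>D\<close> for \<open>n - s\<close> steps is no less likely than avoiding it for
  \<open>n\<close> steps. Summing the probabilities of these disjoint events gives \<open>r\<close> times the expected number of
  visits on the one hand and at most 1 on the other.
\<close>
lemma expected_visits_le:
  fixes X :: "nat \<Rightarrow> 'w \<Rightarrow> 's::countable"
  assumes mc: "markov_chain M S K X"
    and r: "\<And>x. x \<in> S \<inter> D \<Longrightarrow> r \<le> stay_prob K (- D) n x"
  shows "r * (\<integral>\<^sup>+\<omega>. (\<Sum>s\<le>n. indicator D (X s \<omega>)) \<partial>M) \<le> 1"
proof -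
  interpret prob_space M using mc by (simp add: markov_chain_def)
  note [measurable] = measurable_markov_chain[OF mc]
  have *: "r * (\<integral>\<^sup>+\<omega>. indicator D (X s \<omega>) \<partial>M) \<le>
      (\<integral>\<^sup>+\<omega>. indicator D (X s \<omega>) * (\<Prod>j\<in>{s<..n}. indicator (- D) (X j \<omega>)) \<partial>M)" if "s \<le> n" for s
  proof -
    have "r * (\<integral>\<^sup>+\<omega>. indicator D (X s \<omega>) \<partial>M) = (\<integral>\<^sup>+\<omega>. r * indicator D (X s \<omega>) \<partial>M)"
      by (simp add: nn_integral_cmult)
    also have "\<dots> \<le> (\<integral>\<^sup>+\<omega>. indicator D (X s \<omega>) * stay_prob K (- D) (n - s) (X s \<omega>) \<partial>M)"
    proof (rule nn_integral_mono)
      fix \<omega> assume "\<omega> \<in> space M"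
      then have "X s \<omega> \<in> S" by (rule markov_chain_space[OF mc])
      then have "r \<le> stay_prob K (- D) (n - s) (X s \<omega>)" if "X s \<omega> \<in> D"
        using r[of "X s \<omega>"] that antimono_stay_prob[of "n - s" n K "- D" "X s \<omega>"]
        by (auto intro: order.trans)
      then show "r * indicator D (X s \<omega>) \<le> indicator D (X s \<omega>) * stay_prob K (- D) (n - s) (X s \<omega>)"
        by (auto simp: indicator_def)
    qed
    also have "\<dots> = (\<integral>\<^sup>+\<omega>. indicator D (X s \<omega>) * (\<Prod>j\<in>{s<..s + (n - s)}. indicator (- D) (X j \<omega>)) \<partial>M)"
      using nn_integral_stay[OF mc, where t=s and F="\<lambda>y. indicator D (y s)" and n="n - s" and B="- D"] by simp
    finally show ?thesis using that by simp
  qed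
  have "r * (\<integral>\<^sup>+\<omega>. (\<Sum>s\<le>n. indicator D (X s \<omega>)) \<partial>M) =
      (\<Sum>s\<le>n. r * (\<integral>\<^sup>+\<omega>. indicator D (X s \<omega>) \<partial>M))"
    by (subst nn_integral_sum) (auto simp: sum_distrib_left)
  also have "\<dots> \<le> (\<Sum>s\<le>n. (\<integral>\<^sup>+\<omega>. indicator D (X s \<omega>) * (\<Prod>j\<in>{s<..n}. indicator (- D) (X j \<omega>)) \<partial>M))"
    by (intro sum_mono *) simp
  also have "\<dots> = (\<integral>\<^sup>+\<omega>. (\<Sum>s\<le>n. indicator D (X s \<omega>) * (\<Prod>j\<in>{s<..n}. indicator (- D) (X j \<omega>))) \<partial>M)"
    by (rule nn_integral_sum[symmetric]) auto
  also have "\<dots> \<le> (\<integral>\<^sup>+\<omega>. 1 \<partial>M)"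
    by (intro nn_integral_mono last_visit_unique)
  finally show ?thesis by (simp add: emeasure_space_1)
qed

lemma less_return_time_iff: "enat n < return_time x \<omega> \<longleftrightarrow> (\<forall>j\<in>{0<..n}. \<omega> j \<noteq> x)"
proof -
  have "enat n < return_time x \<omega> \<longleftrightarrow> enat (Suc n) \<le> return_time x \<omega>"
    by (metis Suc_ile_eq)
  also have "\<dots> \<longleftrightarrow> (\<forall>j. 1 \<le> j \<and> \<omega> j = x \<longrightarrow> Suc n \<le> j)"
    unfolding return_time_def by (auto simp: le_INF_iff)
  also have "\<dots> \<longleftrightarrow> (\<forall>j\<in>{0<..n}. \<omega> j \<noteq> x)"
    by (metis One_nat_def Suc_le_eq greaterThanAtMost_iff not_less_eq_eq)
  finally show ?thesis .
qed

lemma return_time_tail: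
  fixes K :: "'s::countable \<Rightarrow> 's pmf"
  shows "ennreal (\<P>(\<omega> in markov_law K x. enat n < return_time x \<omega>)) = stay_prob K (- {x}) n x"
proof -
  interpret prob_space "markov_law K x" by (rule prob_space_markov_law)
  note mc = markov_chain_markov_law(1)[where K=K and x=x]
  have [measurable]: "(\<lambda>\<omega>. \<omega> j) \<in> measurable (markov_law K x) (count_space UNIV)" for j
    using measurable_markov_chain[OF mc, of j] by simp
  have ind: "(\<Prod>j\<in>{0<..n}. indicator (- {x}) (\<omega> j)) =
      (indicator {\<omega> \<in> space (markov_law K x). enat n < return_time x \<omega>} \<omega> :: ennreal)" for \<omega>
    by (auto simp: less_return_time_iff space_markov_law indicator_def)
  have [measurable]: "{\<omega> \<in> space (markov_law K x). enat n < return_time x \<omega>} \<in> sets (markov_law K x)"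
    unfolding less_return_time_iff by measurable
  have "emeasure (markov_law K x) {\<omega> \<in> space (markov_law K x). enat n < return_time x \<omega>} =
      (\<integral>\<^sup>+\<omega>. (\<Prod>j\<in>{0<..n}. indicator (- {x}) (\<omega> j)) \<partial>markov_law K x)"
    unfolding ind by simp
  also have "\<dots> = (\<integral>\<^sup>+\<omega>. stay_prob K (- {x}) n (\<omega> 0) \<partial>markov_law K x)"
    using nn_integral_stay[OF mc, where t=0 and F="\<lambda>_. 1" and n=n and B="- {x}"] by simp
  also have "\<dots> = (\<integral>\<^sup>+\<omega>. stay_prob K (- {x}) n x \<partial>markov_law K x)"
    using markov_chain_markov_law(2)[where K=K and x=x] by (intro nn_integral_cong_AE) auto
  also have "\<dots> = stay_prob K (- {x}) n x"
    by (simp add: emeasure_space_1)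
  finally show ?thesis by (simp add: emeasure_eq_measure)
qed

section \<open>Almost sure polynomial bounds for sums\<close>

text \<open>
  Markov's inequality along the times \<open>2 ^ n\<close> leaves a geometric series because \<open>b < \<kappa>\<close>, so the
  Borel-Cantelli lemma applies along these times. Monotonicity fills the gaps: for
  \<open>2 ^ n \<le> t < 2 ^ (n + 1)\<close> the value at \<open>t\<close> is compared with the value at \<open>2 ^ (n + 1)\<close>, which is why the
  bad event at scale \<open>n\<close> asks for an excess over \<open>(2 ^ n) powr \<kappa>\<close> already at time \<open>2 ^ Suc n\<close>.
\<close>
lemma AE_eventually_le_powr:
  fixes Y :: "nat \<Rightarrow> 'w \<Rightarrow> real" and b c \<kappa> :: real
  assumes "finite_measure M"
    and mY[measurable]: "\<And>t. Y t \<in> borel_measurable M"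
    and nonneg: "\<And>t \<omega>. 0 \<le> Y t \<omega>"
    and mono: "\<And>s t \<omega>. s \<le> t \<Longrightarrow> Y s \<omega> \<le> Y t \<omega>"
    and c: "0 \<le> c" and b: "0 \<le> b" "b < \<kappa>"
    and E: "\<forall>\<^sub>F t in sequentially. (\<integral>\<^sup>+\<omega>. ennreal (Y t \<omega>) \<partial>M) \<le> ennreal (c * real t powr b)"
  shows "AE \<omega> in M. \<forall>\<^sub>F t in sequentially. Y t \<omega> \<le> real t powr \<kappa>"
proof -
  interpret finite_measure M by fact
  define A where "A n = {\<omega> \<in> space M. Y (2 ^ Suc n) \<omega> > 2 powr (n * \<kappa>)}" for n :: nat
  have [measurable]: "A n \<in> sets M" for n
    unfolding A_def by measurable
  have mA: "measure M (A n) \<le> c * 2 powr b * (2 powr (b - \<kappa>)) ^ n"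
    if *: "(\<integral>\<^sup>+\<omega>. ennreal (Y (2 ^ Suc n) \<omega>) \<partial>M) \<le> ennreal (c * real (2 ^ Suc n) powr b)" for n
  proof -
    have "ennreal (2 powr (n * \<kappa>) * measure M (A n)) = (\<integral>\<^sup>+\<omega>. ennreal (2 powr (n * \<kappa>)) * indicator (A n) \<omega> \<partial>M)"
      by (simp add: nn_integral_cmult_indicator emeasure_eq_measure ennreal_mult')
    also have "\<dots> \<le> (\<integral>\<^sup>+\<omega>. ennreal (Y (2 ^ Suc n) \<omega>) \<partial>M)"
      by (intro nn_integral_mono) (auto simp: A_def indicator_def intro!: ennreal_leI)
    also note *
    finally have "2 powr (n * \<kappa>) * measure M (A n) \<le> c * real (2 ^ Suc n) powr b"
      using c by (subst (asm) ennreal_le_iff) auto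
    then have "measure M (A n) \<le> c * (real (2 ^ Suc n) powr b / 2 powr (n * \<kappa>))"
      by (simp add: field_simps)
    also have "real (2 ^ Suc n) powr b / 2 powr (n * \<kappa>) = 2 powr b * (2 powr (b - \<kappa>)) ^ n"
    proof -
      have "real (2 ^ Suc n) powr b = 2 powr (real (Suc n) * b)"
        by (metis of_nat_numeral of_nat_power powr_powr powr_realpow zero_less_numeral)
      then show ?thesis
        by (simp add: powr_power powr_add[symmetric] powr_diff[symmetric] algebra_simps)
    qed
    finally show ?thesis by (simp add: mult.assoc)
  qed
  have "filterlim (\<lambda>n::nat. 2 ^ Suc n :: nat) sequentially sequentially"
    by (rule filterlim_subseq) (auto simp: strict_mono_def)
  from eventually_compose_filterlim[OF E this]
  have ev: "\<forall>\<^sub>F n in sequentially. measure M (A n) \<le> c * 2 powr b * (2 powr (b - \<kappa>)) ^ n"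
    by eventually_elim (rule mA)
  have "summable (\<lambda>n. c * 2 powr b * (2 powr (b - \<kappa>)) ^ n)"
    using b by (intro summable_mult summable_geometric) (simp add: powr_less_one)
  then have "summable (\<lambda>n. measure M (A n))"
    by (rule summable_comparison_test_ev[rotated]) (use ev in eventually_elim, simp)
  then have "AE \<omega> in M. \<forall>\<^sub>F n in sequentially. \<omega> \<in> space M - A n"
    by (intro borel_cantelli_AE1) (auto simp: emeasure_eq_measure)
  then show ?thesis
  proof eventually_elim
    case (elim \<omega>)
    then obtain N where N: "\<And>n. n \<ge> N \<Longrightarrow> \<omega> \<in> space M - A n"
      by (auto simp: eventually_sequentially)
    show ?case
      unfolding eventually_sequentially
    proof (intro exI[of _ "2 ^ N"] allI impI)
      fix t :: nat assume t: "2 ^ N \<le> t"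
      then have "1 \<le> t" by (meson le_trans one_le_numeral one_le_power)
      then obtain n where n: "2 ^ n \<le> t" "t < 2 ^ (n + 1)"
        using ex_power_ivl1[of 2 t] by auto
      have "(2::nat) ^ N < 2 ^ (n + 1)" using t n by linarith
      then have "N \<le> n" by (subst (asm) power_strict_increasing_iff) auto
      then have "Y (2 ^ Suc n) \<omega> \<le> 2 powr (n * \<kappa>)"
        using N[of n] by (auto simp: A_def)
      moreover have "Y t \<omega> \<le> Y (2 ^ Suc n) \<omega>"
        using n by (intro mono) simp
      moreover have "2 powr (n * \<kappa>) = real (2 ^ n) powr \<kappa>"
        by (simp add: powr_powr[symmetric] powr_realpow)
      moreover have "real (2 ^ n) powr \<kappa> \<le> real t powr \<kappa>"
        using n b by (intro powr_mono2) (auto simp del: of_nat_power)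
      ultimately show "Y t \<omega> \<le> real t powr \<kappa>" by linarith
    qed
  qed
qed

text \<open>
  For \<open>u\<close> in \<open>[0, 1]\<close> one has \<open>u \<le> u powr a\<close>; apply this to the proportions of \<open>x\<close> and \<open>y\<close> in their sum.
\<close>
lemma powr_add_le_add_powr:
  fixes x y a :: real
  assumes "0 \<le> x" "0 \<le> y" "0 < a" "a \<le> 1"
  shows "(x + y) powr a \<le> x powr a + y powr a"
proof (cases "x + y = 0")
  case True
  with assms show ?thesis by simp
next
  case False
  with assms have pos: "x + y > 0" by simp
  have le: "u \<le> u powr a" if "0 \<le> u" "u \<le> 1" for u :: real
    using that assms powr_mono'[of a 1 u] by (cases "u = 0") auto
  have "1 = x / (x + y) + y / (x + y)"
    using pos by (simp add: add_divide_distrib[symmetric])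
  also have "\<dots> \<le> (x / (x + y)) powr a + (y / (x + y)) powr a"
    using assms pos by (intro add_mono le) auto
  also have "\<dots> = (x powr a + y powr a) / (x + y) powr a"
    using assms pos by (simp add: powr_divide add_divide_distrib)
  finally show ?thesis
    using pos by (simp add: field_simps)
qed

lemma powr_sum_le_sum_powr:
  fixes f :: "'a \<Rightarrow> real"
  assumes "finite I" "\<And>i. i \<in> I \<Longrightarrow> 0 \<le> f i" "0 < a" "a \<le> 1"
  shows "(\<Sum>i\<in>I. f i) powr a \<le> (\<Sum>i\<in>I. f i powr a)"
  using assms(1,2)
proof (induction I rule: finite_induct)
  case empty
  then show ?case using assms by simp
next
  case (insert i I)
  have "(f i + (\<Sum>i\<in>I. f i)) powr a \<le> f i powr a + (\<Sum>i\<in>I. f i) powr a"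
    using insert assms(3,4) by (intro powr_add_le_add_powr sum_nonneg) auto
  with insert show ?case by auto
qed

text \<open>
  The form in which moments of order \<open>a \<le> 1\<close> are used. Subadditivity of the power controls the sum of
  the \<open>D s\<close> by the sum of the \<open>D s powr a\<close>, whose expectation is additive.
\<close>
lemma AE_eventually_sum_le_powr:
  fixes D :: "nat \<Rightarrow> 'w \<Rightarrow> real" and a b c \<kappa> :: real
  assumes "finite_measure M"
    and mD[measurable]: "\<And>s. D s \<in> borel_measurable M"
    and nonneg: "\<And>s \<omega>. 0 \<le> D s \<omega>"
    and a: "0 < a" "a \<le> 1" and c: "0 \<le> c" and b: "0 \<le> b" "b / a < \<kappa>"
    and E: "\<forall>\<^sub>F t in sequentially.
      (\<integral>\<^sup>+\<omega>. (\<Sum>s<t. ennreal (D s \<omega> powr a)) \<partial>M) \<le> ennreal (c * real t powr b)"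
  shows "AE \<omega> in M. \<forall>\<^sub>F t in sequentially. (\<Sum>s<t. D s \<omega>) \<le> real t powr \<kappa>"
proof -
  have "AE \<omega> in M. \<forall>\<^sub>F t in sequentially. (\<Sum>s<t. D s \<omega> powr a) \<le> real t powr (\<kappa> * a)"
  proof (rule AE_eventually_le_powr[OF assms(1)])
    show "b < \<kappa> * a" using a b by (simp add: field_simps)
    show "\<forall>\<^sub>F t in sequentially. (\<integral>\<^sup>+\<omega>. ennreal (\<Sum>s<t. D s \<omega> powr a) \<partial>M) \<le> ennreal (c * real t powr b)"
      using E by simp
    show "(\<Sum>s<t. D s \<omega> powr a) \<le> (\<Sum>s<t'. D s \<omega> powr a)" if "t \<le> t'" for t t' \<omega>
      using that by (intro sum_mono2) auto
  qed (use c b in \<open>auto intro: sum_nonneg\<close>)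
  then show ?thesis
  proof eventually_elim
    case (elim \<omega>)
    then show ?case
    proof eventually_elim
      case (elim t)
      have "(\<Sum>s<t. D s \<omega>) powr a \<le> real t powr (\<kappa> * a)"
        using powr_sum_le_sum_powr[of "{..<t}" "\<lambda>s. D s \<omega>" a] a nonneg elim by auto
      then have "((\<Sum>s<t. D s \<omega>) powr a) powr (1 / a) \<le> (real t powr (\<kappa> * a)) powr (1 / a)"
        using a by (intro powr_mono2) auto
      then show ?case
        using a nonneg by (simp add: powr_powr sum_nonneg)
    qed
  qed
qed

section \<open>Tails and moments\<close>

text \<open>
  A tail decaying like \<open>x powr (- b)\<close> has moments of every order \<open>a < b\<close>. The bound depends on \<open>a\<close>, \<open>b\<close>
  and the scale \<open>k0\<close> from which the tail bound holds, and on nothing else, so it is uniform over any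
  family of laws that share these three. The factor \<open>(2 ^ k0) powr b\<close> makes the tail bound valid at the
  scales below \<open>k0\<close> as well, where probabilities are estimated by 1.
\<close>
lemma nn_integral_powr_le_of_dyadic_tail:
  fixes p :: "'a pmf" and Y :: "'a \<Rightarrow> real" and a b :: real
  assumes Y: "\<And>x. 0 \<le> Y x" and a: "0 < a" "a < b"
    and tail: "\<And>k. k0 \<le> k \<Longrightarrow> measure_pmf.prob p {x. Y x > 2 ^ k} \<le> (2 ^ k) powr (- b)"
  shows "(\<integral>\<^sup>+x. ennreal (Y x powr a) \<partial>measure_pmf p) \<le>
    ennreal (1 + 2 powr a * (2 ^ k0) powr b / (1 - 2 powr (a - b)))"
proof -
  have pointwise: "ennreal (Y x powr a) \<le>
      1 + (\<Sum>k. ennreal ((2 ^ Suc k) powr a) * indicator {x. Y x > 2 ^ k} x)" for x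
  proof (cases "Y x \<le> 1")
    case True
    then have "Y x powr a \<le> 1 powr a"
      using a Y by (intro powr_mono2) auto
    then have "ennreal (Y x powr a) \<le> 1" by simp
    also have "\<dots> \<le> 1 + (\<Sum>k. ennreal ((2 ^ Suc k) powr a) * indicator {x. Y x > 2 ^ k} x)"
      by (rule add_increasing2) auto
    finally show ?thesis .
  next
    case False
    define n where "n = (LEAST n. Y x \<le> 2 ^ n)"
    have ex: "\<exists>n. Y x \<le> 2 ^ n"
      using real_arch_pow[of 2 "Y x"] by (auto intro: less_imp_le)
    have n: "Y x \<le> 2 ^ n"
      unfolding n_def by (rule LeastI_ex[OF ex])
    with False have "n \<noteq> 0" by (intro notI) simp
    then obtain k where k: "n = Suc k" by (cases n) auto
    have "\<not> Y x \<le> 2 ^ k"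
      by (rule not_less_Least) (simp add: n_def[symmetric] k)
    moreover have "Y x powr a \<le> (2 ^ Suc k) powr a"
      using n Y a unfolding k by (intro powr_mono2) auto
    ultimately have "ennreal (Y x powr a) \<le>
        ennreal ((2 ^ Suc k) powr a) * indicator {x. Y x > 2 ^ k} x"
      by (simp add: ennreal_leI)
    also have "\<dots> \<le> (\<Sum>k. ennreal ((2 ^ Suc k) powr a) * indicator {x. Y x > 2 ^ k} x)"
      (is "?f k \<le> _")
    proof -
      have "?f k = sum ?f {k}" by (subst sum.insert) auto
      also have "\<dots> \<le> suminf ?f" by (rule sum_le_suminf) auto
      finally show ?thesis .
    qed
    also have "\<dots> \<le> 1 + (\<Sum>k. ennreal ((2 ^ Suc k) powr a) * indicator {x. Y x > 2 ^ k} x)"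
      by (rule add_increasing) auto
    finally show ?thesis .
  qed
  define q where "q = 2 powr (a - b)"
  have q: "0 < q" "q < 1" using a by (auto simp: q_def powr_less_one)
  have weak: "measure_pmf.prob p {x. Y x > 2 ^ k} \<le> (2 ^ k0) powr b * (2 ^ k) powr (- b)" for k
  proof (cases "k0 \<le> k")
    case True
    have "1 \<le> (2 ^ k0 :: real) powr b"
      using a by (intro ge_one_powr_ge_zero) auto
    then have "1 * (2 ^ k) powr (- b) \<le> (2 ^ k0) powr b * (2 ^ k :: real) powr (- b)"
      by (intro mult_right_mono) auto
    with tail[OF True] show ?thesis by linarith
  next
    case False
    have "(2 ^ k :: real) powr b \<le> (2 ^ k0) powr b"
      using False a by (intro powr_mono2) auto
    then have "1 \<le> (2 ^ k0) powr b * (2 ^ k :: real) powr (- b)"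
      by (simp add: powr_minus field_simps)
    moreover have "measure_pmf.prob p {x. Y x > 2 ^ k} \<le> 1" by simp
    ultimately show ?thesis by linarith
  qed
  have summand: "ennreal ((2 ^ Suc k) powr a) * emeasure p {x. Y x > 2 ^ k} \<le>
      ennreal (2 powr a * (2 ^ k0) powr b * q ^ k)" for k
  proof -
    have "ennreal ((2 ^ Suc k) powr a) * emeasure p {x. Y x > 2 ^ k} \<le>
        ennreal ((2 ^ Suc k) powr a * ((2 ^ k0) powr b * (2 ^ k) powr (- b)))"
      unfolding measure_pmf.emeasure_eq_measure ennreal_mult'[symmetric, OF powr_ge_zero]
      by (intro ennreal_leI mult_left_mono weak) auto
    also have "(2 ^ Suc k) powr a * ((2 ^ k0) powr b * (2 ^ k :: real) powr (- b)) =
        2 powr a * (2 ^ k0) powr b * q ^ k"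
      by (simp add: q_def powr_mult powr_power powr_diff powr_minus field_simps
          powr_realpow[symmetric] powr_powr)
    finally show ?thesis .
  qed
  have "(\<integral>\<^sup>+x. ennreal (Y x powr a) \<partial>measure_pmf p) \<le>
      (\<integral>\<^sup>+x. 1 + (\<Sum>k. ennreal ((2 ^ Suc k) powr a) * indicator {x. Y x > 2 ^ k} x) \<partial>measure_pmf p)"
    by (intro nn_integral_mono pointwise)
  also have "\<dots> = 1 + (\<Sum>k. ennreal ((2 ^ Suc k) powr a) * emeasure p {x. Y x > 2 ^ k})"
    by (subst nn_integral_add) (simp_all add: nn_integral_suminf nn_integral_cmult)
  also have "\<dots> \<le> 1 + (\<Sum>k. ennreal (2 powr a * (2 ^ k0) powr b * q ^ k))"
    by (intro add_left_mono suminf_le summand) auto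
  also have "(\<Sum>k. ennreal (2 powr a * (2 ^ k0) powr b * q ^ k)) =
      ennreal (2 powr a * (2 ^ k0) powr b * (1 / (1 - q)))"
    by (intro suminf_ennreal_eq sums_mult geometric_sums) (use q in auto)
  also have "1 + ennreal (2 powr a * (2 ^ k0) powr b * (1 / (1 - q))) =
      ennreal (1 + 2 powr a * (2 ^ k0) powr b / (1 - q))"
    using ennreal_plus[of 1 "2 powr a * (2 ^ k0) powr b / (1 - q)"] q by simp
  finally show ?thesis
    by (simp add: q_def)
qed

text \<open>
  The hypothesis \<open>\<epsilon> \<le> \<rho>\<close> excludes \<open>y = 0\<close>:
  since \<open>ln 0 = 0\<close>, the ratio would then be 0, at distance \<open>\<rho>\<close> from the limit.
\<close>
lemma powr_bounds_of_ln_ratio: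
  fixes x y \<rho> \<epsilon> :: real
  assumes "1 < x" "0 \<le> y" "\<epsilon> \<le> \<rho>" and d: "dist (ln y / ln x) (- \<rho>) < \<epsilon>"
  shows "x powr (- \<rho> - \<epsilon>) \<le> y" "y \<le> x powr (- \<rho> + \<epsilon>)"
proof -
  have "y \<noteq> 0" using assms by (auto simp: dist_real_def)
  with assms have y: "0 < y" by simp
  have lx: "0 < ln x" using assms by simp
  have "(- \<rho> - \<epsilon>) * ln x \<le> ln y" "ln y \<le> (- \<rho> + \<epsilon>) * ln x"
    using d lx by (auto simp: dist_real_def abs_less_iff field_simps)
  then show "x powr (- \<rho> - \<epsilon>) \<le> y" "y \<le> x powr (- \<rho> + \<epsilon>)"
    using y \<open>1 < x\<close> by (auto simp: powr_def ln_ge_iff[symmetric] ln_le_cancel_iff[of y "exp _", simplified, symmetric])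
qed

section \<open>Existence of a large jump\<close>

lemma measurable_markov_pair:
  fixes X :: "nat \<Rightarrow> 'w \<Rightarrow> 's::countable"
  assumes mc: "markov_chain M S K X" and "\<And>x z. g x z \<in> space N"
  shows "(\<lambda>\<omega>. g (X s \<omega>) (X t \<omega>)) \<in> measurable M N"
proof (rule measurable_compose_countable[where f="\<lambda>i \<omega>. g i (X t \<omega>)", OF _ measurable_markov_chain[OF mc]])
  show "(\<lambda>\<omega>. g i (X t \<omega>)) \<in> measurable M N" for i
    by (rule measurable_compose[OF measurable_markov_chain[OF mc]]) (use assms(2) in simp)
qed

text \<open>
  Each step from \<open>B\<close> escapes the jump \<open>J\<close> with conditional probability at most \<open>1 - p \<le> exp (- p)\<close>, so
  the weight \<open>exp p\<close> for a step from \<open>B\<close> without jump, 0 for a step from \<open>B\<close> with jump and 1 for any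
  other step has conditional mean at most 1. On the event in question at least half of the \<open>t\<close> steps
  start in \<open>B\<close>, and the product of the weights is at least \<open>exp (p * t / 2)\<close>.
\<close>
lemma prob_no_jump_le:
  fixes X :: "nat \<Rightarrow> 'w \<Rightarrow> 's::countable" and J :: "'s \<Rightarrow> 's \<Rightarrow> bool" and p :: real
  assumes mc: "markov_chain M S K X"
    and p: "\<And>x. x \<in> S \<inter> B \<Longrightarrow> p \<le> measure_pmf.prob (K x) {z. J x z}" "0 \<le> p"
  shows "\<P>(\<omega> in M. (\<forall>s<t. X s \<omega> \<in> B \<longrightarrow> \<not> J (X s \<omega>) (X (Suc s) \<omega>)) \<and>
      2 * (\<Sum>s<t. indicator (- B) (X s \<omega>)) \<le> real t) \<le> exp (- (p * real t / 2))"
proof -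
  interpret prob_space M using mc by (simp add: markov_chain_def)
  note [measurable] = measurable_markov_chain[OF mc]
  have [measurable]: "Measurable.pred M (\<lambda>\<omega>. J (X s \<omega>) (X (Suc s) \<omega>))" for s
    by (rule measurable_markov_pair[OF mc]) simp
  define E where "E = {\<omega> \<in> space M. (\<forall>s<t. X s \<omega> \<in> B \<longrightarrow> \<not> J (X s \<omega>) (X (Suc s) \<omega>)) \<and>
      2 * (\<Sum>s<t. indicator (- B) (X s \<omega>)) \<le> real t}"
  have [measurable]: "E \<in> sets M" unfolding E_def by measurable
  define w :: "'s \<Rightarrow> 's \<Rightarrow> ennreal"
    where "w x z = (if x \<in> B then ennreal (exp p) * indicator {z. \<not> J x z} z else 1)" for x z
  have "(\<integral>\<^sup>+z. w x z \<partial>measure_pmf (K x)) \<le> 1" if "x \<in> S" for x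
  proof (cases "x \<in> B")
    case True
    have "measure_pmf.prob (K x) {z. \<not> J x z} = 1 - measure_pmf.prob (K x) {z. J x z}"
      using measure_pmf.prob_compl[of "{z. J x z}" "K x"] by (simp add: Compl_eq_Diff_UNIV[symmetric] Collect_neg_eq)
    also have "\<dots> \<le> 1 - p" using p(1)[of x] True that by simp
    also have "\<dots> \<le> exp (- p)" using exp_ge_add_one_self[of "- p"] by simp
    finally have "exp p * measure_pmf.prob (K x) {z. \<not> J x z} \<le> exp p * exp (- p)"
      by (intro mult_left_mono) auto
    then have "exp p * measure_pmf.prob (K x) {z. \<not> J x z} \<le> 1"
      by (simp add: exp_minus)
    then show ?thesis
      using True by (simp add: w_def nn_integral_cmult measure_pmf.emeasure_eq_measure
          ennreal_mult'[symmetric])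
  qed (simp add: w_def)
  then have "(\<integral>\<^sup>+\<omega>. (\<Prod>s<t. w (X s \<omega>) (X (Suc s) \<omega>)) \<partial>M) \<le> 1"
    by (rule nn_integral_multiplicative_le_1[OF mc])
  moreover have "ennreal (exp (p * real t / 2)) * indicator E \<omega> \<le> (\<Prod>s<t. w (X s \<omega>) (X (Suc s) \<omega>))" for \<omega>
  proof (cases "\<omega> \<in> E")
    case True
    have "(\<Prod>s<t. w (X s \<omega>) (X (Suc s) \<omega>)) = (\<Prod>s<t. ennreal (exp (p * indicator B (X s \<omega>))))"
      using True by (intro prod.cong) (auto simp: w_def E_def)
    also have "\<dots> = ennreal (exp (p * (\<Sum>s<t. indicator B (X s \<omega>))))"
      by (simp add: prod_ennreal exp_sum[symmetric] sum_distrib_left)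
    finally have eq: "(\<Prod>s<t. w (X s \<omega>) (X (Suc s) \<omega>)) = ennreal (exp (p * (\<Sum>s<t. indicator B (X s \<omega>))))" .
    have "(\<Sum>s<t. indicator B (X s \<omega>)) + (\<Sum>s<t. indicator (- B) (X s \<omega>)) = (\<Sum>s<t. 1 :: real)"
      unfolding sum.distrib[symmetric] by (rule sum.cong) (auto simp: indicator_def)
    then have "real t / 2 \<le> (\<Sum>s<t. indicator B (X s \<omega>))"
      using True by (simp add: E_def)
    then have "p * (real t / 2) \<le> p * (\<Sum>s<t. indicator B (X s \<omega>))"
      using p(2) by (rule mult_left_mono)
    then show ?thesis
      using True by (simp add: eq ennreal_leI)
  qed simp
  then have "(\<integral>\<^sup>+\<omega>. ennreal (exp (p * real t / 2)) * indicator E \<omega> \<partial>M) \<le>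
      (\<integral>\<^sup>+\<omega>. (\<Prod>s<t. w (X s \<omega>) (X (Suc s) \<omega>)) \<partial>M)"
    by (intro nn_integral_mono)
  ultimately have "ennreal (exp (p * real t / 2)) * emeasure M E \<le> 1"
    by (simp add: nn_integral_cmult)
  then have "exp (p * real t / 2) * prob E \<le> 1"
    by (simp add: emeasure_eq_measure ennreal_mult'[symmetric])
  then show ?thesis
    unfolding E_def by (simp add: exp_minus field_simps)
qed

lemma AE_eventually_jump:
  fixes X :: "nat \<Rightarrow> 'w \<Rightarrow> 's::countable" and J :: "nat \<Rightarrow> 's \<Rightarrow> 's \<Rightarrow> bool" and p :: "nat \<Rightarrow> real"
  assumes mc: "markov_chain M S K X"
    and p: "\<forall>\<^sub>F t in sequentially. 0 \<le> p t \<and> (\<forall>x\<in>S \<inter> B. p t \<le> measure_pmf.prob (K x) {z. J t x z})"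
    and sum: "summable (\<lambda>t. exp (- (p t * real t / 2)))"
    and sparse: "AE \<omega> in M. \<forall>\<^sub>F t in sequentially. 2 * (\<Sum>s<t. indicator (- B) (X s \<omega>)) \<le> real t"
  shows "AE \<omega> in M. \<forall>\<^sub>F t in sequentially. \<exists>s<t. X s \<omega> \<in> B \<and> J t (X s \<omega>) (X (Suc s) \<omega>)"
proof -
  interpret prob_space M using mc by (simp add: markov_chain_def)
  note [measurable] = measurable_markov_chain[OF mc]
  have [measurable]: "Measurable.pred M (\<lambda>\<omega>. J t (X s \<omega>) (X (Suc s) \<omega>))" for s t
    by (rule measurable_markov_pair[OF mc]) simp
  define E where "E t = {\<omega> \<in> space M. (\<forall>s<t. X s \<omega> \<in> B \<longrightarrow> \<not> J t (X s \<omega>) (X (Suc s) \<omega>)) \<and>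
      2 * (\<Sum>s<t. indicator (- B) (X s \<omega>)) \<le> real t}" for t
  have [measurable]: "E t \<in> sets M" for t unfolding E_def by measurable
  have "\<forall>\<^sub>F t in sequentially. prob (E t) \<le> exp (- (p t * real t / 2))"
    using p unfolding E_def by eventually_elim (rule prob_no_jump_le[OF mc], auto)
  then have "summable (\<lambda>t. prob (E t))"
    by (intro summable_comparison_test_ev[OF _ sum]) simp
  then have "AE \<omega> in M. \<forall>\<^sub>F t in sequentially. \<omega> \<in> space M - E t"
    by (intro borel_cantelli_AE1) (auto simp: emeasure_eq_measure)
  with sparse show ?thesis
  proof eventually_elim
    case (elim \<omega>)
    then show ?case by eventually_elim (auto simp: E_def)
  qed
qed

section \<open>Sums of increments of the strip chain\<close>

abbreviation incr :: "(nat \<Rightarrow> 'w \<Rightarrow> int) \<Rightarrow> nat \<Rightarrow> 'w \<Rightarrow> int" where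
  "incr V s \<omega> \<equiv> V (Suc s) \<omega> - V s \<omega>"

lemma pos_part_nonneg [simp]: "0 \<le> pos_part x"
  and neg_part_nonneg [simp]: "0 \<le> neg_part x"
  by (auto simp: pos_part_def neg_part_def indicator_def)

lemma pos_part_minus_neg_part: "pos_part x - neg_part x = x"
  by (auto simp: pos_part_def neg_part_def indicator_def)

text \<open>
  Leaving or avoiding a line is decided by the first coordinate, hence by the induced chain. This is
  where the law of the return time, given for the induced chain, enters the strip.
\<close>
lemma stay_prob_strip:
  "stay_prob (strip_kernel \<phi>) (- ({l0} \<times> UNIV)) n (l, x) = stay_prob (induced_kernel \<phi>) (- {l0}) n l"
proof (induction n arbitrary: l x)
  case (Suc n)
  have "indicator (- ({l0} \<times> UNIV)) (a, b) = (indicator (- {l0}) a :: ennreal)" for a and b :: int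
    by (auto simp: indicator_def)
  with Suc show ?case
    by (simp add: strip_kernel_def induced_kernel_def split_def)
qed simp

lemma nn_integral_strip_sum_le:
  fixes h :: "nat \<Rightarrow> int \<Rightarrow> ennreal" and g :: "nat \<Rightarrow> ennreal"
  assumes mc: "markov_chain M (A \<times> UNIV) (strip_kernel \<phi>) (\<lambda>t \<omega>. (U t \<omega>, V t \<omega>))"
    and h: "\<And>l. l \<in> A \<Longrightarrow> (\<integral>\<^sup>+z. h l (snd z) \<partial>measure_pmf (\<phi> l)) \<le> c * g l"
  shows "(\<integral>\<^sup>+\<omega>. (\<Sum>s<t. h (U s \<omega>) (incr V s \<omega>)) \<partial>M) \<le> c * (\<integral>\<^sup>+\<omega>. (\<Sum>s<t. g (U s \<omega>)) \<partial>M)"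
proof -
  note [measurable] = measurable_markov_chain[OF mc]
  have [measurable]: "(\<lambda>\<omega>. g (U s \<omega>)) \<in> borel_measurable M" for s
    using measurable_markov_pair[OF mc, of "\<lambda>(l, x) z. g l" borel s s] by simp
  have [measurable]: "(\<lambda>\<omega>. h (U s \<omega>) (incr V s \<omega>)) \<in> borel_measurable M" for s
    using measurable_markov_pair[OF mc, of "\<lambda>(l, x) (l', x'). h l (x' - x)" borel s "Suc s"] by simp
  have "(\<integral>\<^sup>+\<omega>. h (U s \<omega>) (incr V s \<omega>) \<partial>M) \<le> c * (\<integral>\<^sup>+\<omega>. g (U s \<omega>) \<partial>M)" for s
  proof -
    have "(\<integral>\<^sup>+\<omega>. h (U s \<omega>) (incr V s \<omega>) \<partial>M) =
        (\<integral>\<^sup>+\<omega>. (\<integral>\<^sup>+z. h (U s \<omega>) (snd z) \<partial>measure_pmf (\<phi> (U s \<omega>))) \<partial>M)"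
      using nn_integral_markov_step[OF mc, of "\<lambda>(l, x) (l', x'). h l (x' - x)" s]
      by (simp add: strip_kernel_def split_def)
    also have "\<dots> \<le> (\<integral>\<^sup>+\<omega>. c * g (U s \<omega>) \<partial>M)"
      using markov_chain_space[OF mc, of _ s] by (intro nn_integral_mono h) auto
    finally show ?thesis by (simp add: nn_integral_cmult)
  qed
  then show ?thesis
    by (simp add: nn_integral_sum sum_distrib_left sum_mono)
qed

text \<open>
  The moment hypothesis allows a line-dependent factor \<open>g\<close>, so that both cases of interest are
  covered: \<open>g = 1\<close>, where the expected sum grows linearly (\<open>b = 1\<close>), and \<open>g\<close> the indicator of the line
  0, where it grows like the number of visits to that line.
\<close>
lemma AE_strip_sum_le_powr:
  fixes f :: "nat \<Rightarrow> int \<Rightarrow> real" and g :: "nat \<Rightarrow> real" and a b \<kappa> :: real and c :: ennreal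
  assumes mc: "markov_chain M (A \<times> UNIV) (strip_kernel \<phi>) (\<lambda>t \<omega>. (U t \<omega>, V t \<omega>))"
    and f: "\<And>l d. 0 \<le> f l d"
    and a: "0 < a" "a \<le> 1" and b: "0 \<le> b" "b / a < \<kappa>" and c: "c < \<infinity>"
    and moment: "\<And>l. l \<in> A \<Longrightarrow>
      (\<integral>\<^sup>+z. ennreal (f l (snd z) powr a) \<partial>measure_pmf (\<phi> l)) \<le> c * ennreal (g l)"
    and g: "\<forall>\<^sub>F t in sequentially.
      (\<integral>\<^sup>+\<omega>. (\<Sum>s<t. ennreal (g (U s \<omega>))) \<partial>M) \<le> ennreal (real t powr b)"
  shows "AE \<omega> in M. \<forall>\<^sub>F t in sequentially. (\<Sum>s<t. f (U s \<omega>) (incr V s \<omega>)) \<le> real t powr \<kappa>"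
proof (rule AE_eventually_sum_le_powr[OF _ _ _ a _ b])
  show "finite_measure M"
    using mc by (simp add: markov_chain_def prob_space.finite_measure)
  show "(\<lambda>\<omega>. f (U s \<omega>) (incr V s \<omega>)) \<in> borel_measurable M" for s
    using measurable_markov_pair[OF mc, of "\<lambda>(l, x) (l', x'). f l (x' - x)" borel s "Suc s"] by simp
  show "\<forall>\<^sub>F t in sequentially. (\<integral>\<^sup>+\<omega>. (\<Sum>s<t. ennreal (f (U s \<omega>) (incr V s \<omega>) powr a)) \<partial>M) \<le>
      ennreal (enn2real c * real t powr b)"
    using g
  proof eventually_elim
    case (elim t)
    have "(\<integral>\<^sup>+\<omega>. (\<Sum>s<t. ennreal (f (U s \<omega>) (incr V s \<omega>) powr a)) \<partial>M) \<le>
        c * (\<integral>\<^sup>+\<omega>. (\<Sum>s<t. ennreal (g (U s \<omega>))) \<partial>M)"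
      by (rule nn_integral_strip_sum_le[OF mc, of "\<lambda>l d. ennreal (f l d powr a)"]) (rule moment)
    also have "\<dots> \<le> c * ennreal (real t powr b)"
      by (intro mult_left_mono elim) simp
    also have "\<dots> = ennreal (enn2real c * real t powr b)"
      using c by (simp add: ennreal_mult)
    finally show ?case .
  qed
qed (use f in auto)

text \<open>
  By the last-exit decomposition the expected number of visits to the line 0 before time \<open>t\<close> is at most
  the inverse of the probability that the return time exceeds \<open>t\<close>.
\<close>
lemma expected_visits_powr:
  assumes "0 \<in> A"
    and mc: "markov_chain M (A \<times> UNIV) (strip_kernel \<phi>) (\<lambda>t \<omega>. (U t \<omega>, V t \<omega>))"
    and "0 < \<gamma>" "\<gamma> < b"
    and tail: "(\<lambda>t::nat. ln (\<P>(\<omega> in markov_law (induced_kernel \<phi>) 0. return_time 0 \<omega> > enat t)) / ln (real t))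
           \<longlonglongrightarrow> - \<gamma>"
  shows "\<forall>\<^sub>F t in sequentially. (\<integral>\<^sup>+\<omega>. (\<Sum>s<t. ennreal (indicator {0} (U s \<omega>))) \<partial>M) \<le> ennreal (real t powr b)"
proof -
  define \<epsilon> where "\<epsilon> = min (b - \<gamma>) \<gamma>"
  have \<epsilon>: "0 < \<epsilon>" "\<epsilon> \<le> \<gamma>" "\<gamma> + \<epsilon> \<le> b" using assms by (auto simp: \<epsilon>_def)
  let ?r = "\<lambda>t. \<P>(\<omega> in markov_law (induced_kernel \<phi>) 0. return_time 0 \<omega> > enat t)"
  from tendstoD[OF tail \<epsilon>(1)] eventually_gt_at_top[of 1] show ?thesis
  proof eventually_elim
    case (elim t)
    then have t: "1 < real t" by simp
    have "real t powr (- b) \<le> real t powr (- \<gamma> - \<epsilon>)"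
      using t \<epsilon> by (intro powr_mono) auto
    also have "\<dots> \<le> ?r t"
      by (rule powr_bounds_of_ln_ratio(1)[OF t _ \<epsilon>(2) elim(1)]) simp
    finally have "ennreal (real t powr (- b)) \<le> ennreal (?r t)"
      by (rule ennreal_leI)
    then have "ennreal (real t powr (- b)) \<le> stay_prob (strip_kernel \<phi>) (- ({0} \<times> UNIV)) t x"
      if "x \<in> (A \<times> UNIV) \<inter> ({0} \<times> UNIV)" for x
      using that unfolding return_time_tail by (cases x) (auto simp: stay_prob_strip simp del: Compl_Times_UNIV2 Compl_Times_UNIV1)
    from expected_visits_le[OF mc, of "{0} \<times> UNIV", OF this]
    have *: "ennreal (real t powr (- b)) *
        (\<integral>\<^sup>+\<omega>. (\<Sum>s\<le>t. indicator ({0} \<times> UNIV) (U s \<omega>, V s \<omega>)) \<partial>M) \<le> 1" .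
    have "(\<integral>\<^sup>+\<omega>. (\<Sum>s<t. ennreal (indicator {0} (U s \<omega>))) \<partial>M) \<le>
        (\<integral>\<^sup>+\<omega>. (\<Sum>s\<le>t. indicator ({0} \<times> UNIV) (U s \<omega>, V s \<omega>)) \<partial>M)" (is "_ \<le> ?N")
    proof (rule nn_integral_mono)
      fix \<omega>
      have eq: "ennreal (indicator {0} (U s \<omega>)) = indicator ({0} \<times> UNIV) (U s \<omega>, V s \<omega>)" for s
        by (auto simp: indicator_def)
      show "(\<Sum>s<t. ennreal (indicator {0} (U s \<omega>))) \<le> (\<Sum>s\<le>t. indicator ({0} \<times> UNIV) (U s \<omega>, V s \<omega>))"
        unfolding eq by (rule sum_mono2) auto
    qed
    also have "\<dots> = ennreal (real t powr b) * (ennreal (real t powr (- b)) * ?N)"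
      using t by (simp add: mult.assoc[symmetric] ennreal_mult'[symmetric] powr_add[symmetric])
    also have "\<dots> \<le> ennreal (real t powr b) * 1"
      by (intro mult_left_mono *) simp
    finally show ?case by simp
  qed
qed

section \<open>Comparison of powers of the time\<close>

lemma summable_exp_minus_powr:
  fixes \<eta> :: real
  assumes "0 < \<eta>"
  shows "summable (\<lambda>t::nat. exp (- (real t powr \<eta> / 2)))"
proof (rule summable_comparison_test_ev)
  show "summable (\<lambda>t. real t powr (- 2))"
    by (simp add: summable_real_powr_iff)
  show "\<forall>\<^sub>F t::nat in sequentially. norm (exp (- (real t powr \<eta> / 2))) \<le> real t powr (- 2)"
  proof -
    have "(\<lambda>t::nat. ln (real t) / real t powr \<eta>) \<longlonglongrightarrow> 0"
      using lim_ln_over_power[OF assms] .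
    then have "\<forall>\<^sub>F t::nat in sequentially. ln (real t) / real t powr \<eta> < 1 / 4"
      by (rule order_tendstoD(2)) simp
    then show ?thesis
      using eventually_gt_at_top[of 0]
    proof eventually_elim
      case (elim t)
      then have "2 * ln (real t) \<le> real t powr \<eta> / 2"
        by (simp add: field_simps)
      with elim show ?case by (simp add: powr_def[of _ "- 2"])
    qed
  qed
qed

lemma eventually_powr_le_powr:
  fixes c k k0 m :: real
  assumes "k < m" "k0 < m" "0 < m"
  shows "\<forall>\<^sub>F t::nat in sequentially. c + 2 * real t powr k0 + real t powr k \<le> real t powr m"
proof -
  have neg: "(\<lambda>t::nat. real t powr e) \<longlonglongrightarrow> 0" if "e < 0" for e
    using that by (intro tendsto_neg_powr filterlim_real_sequentially)
  have "(\<lambda>t::nat. c * real t powr (- m) + 2 * real t powr (k0 - m) + real t powr (k - m)) \<longlonglongrightarrow>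
      c * 0 + 2 * 0 + 0"
    using assms by (intro tendsto_intros neg) auto
  then have "\<forall>\<^sub>F t::nat in sequentially.
      c * real t powr (- m) + 2 * real t powr (k0 - m) + real t powr (k - m) < 1"
    by (rule order_tendstoD(2)) simp
  then show ?thesis
    using eventually_gt_at_top[of 0]
  proof eventually_elim
    case (elim t)
    then have "(c * real t powr (- m) + 2 * real t powr (k0 - m) + real t powr (k - m)) * real t powr m \<le>
        1 * real t powr m"
      by (intro mult_right_mono) auto
    with elim show ?case
      by (simp add: ring_distribs mult.assoc powr_add[symmetric])
  qed
qed

text \<open>
  An arbitrarily small change of the exponent of \<open>G\<close> absorbs the error, so \<open>- v\<close> inherits the growth
  exponent of \<open>G\<close>, and with it positivity. The exponents are taken from two sequences
  converging to \<open>b\<close>, so that the hypotheses can hold simultaneously outside one null set.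
\<close>
lemma drift_asymptotics:
  fixes v G :: "nat \<Rightarrow> real" and b c k0 :: real
  assumes b: "0 < b" and k0: "k0 < b"
    and lower: "\<And>n::nat. \<forall>\<^sub>F t in sequentially. real t powr (b * (1 - 1 / (real n + 2))) \<le> G t"
    and upper: "\<And>n::nat. \<forall>\<^sub>F t in sequentially. G t \<le> real t powr (b * (1 + 1 / (real n + 2)))"
    and err: "\<forall>\<^sub>F t in sequentially. \<bar>v t + G t\<bar> \<le> c + 2 * real t powr k0"
  shows "filterlim v at_bot sequentially" and "(\<lambda>t. ln \<bar>v t\<bar> / ln (real t)) \<longlonglongrightarrow> b"
proof -
  have low: "\<forall>\<^sub>F t in sequentially. real t powr k \<le> - v t" if "k < b" for k
  proof -
    have "(\<lambda>n. b * (1 - 1 / (real n + 2))) \<longlonglongrightarrow> b"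
      by real_asymp
    then have "\<forall>\<^sub>F n::nat in sequentially. max (max k k0) 0 < b * (1 - 1 / (real n + 2))"
      using that k0 b by (intro order_tendstoD(1)) auto
    then obtain n :: nat where n: "max (max k k0) 0 < b * (1 - 1 / (real n + 2))"
      unfolding eventually_sequentially by blast
    from n have "\<forall>\<^sub>F t::nat in sequentially.
        c + 2 * real t powr k0 + real t powr k \<le> real t powr (b * (1 - 1 / (real n + 2)))"
      by (intro eventually_powr_le_powr) auto
    with lower[of n] err show ?thesis
      by eventually_elim linarith
  qed
  have up: "\<forall>\<^sub>F t in sequentially. - v t \<le> real t powr k" if "b < k" for k
  proof -
    have "(\<lambda>n. b * (1 + 1 / (real n + 2))) \<longlonglongrightarrow> b"
      by real_asymp
    from order_tendstoD(2)[OF this that]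
    obtain n :: nat where n: "b * (1 + 1 / (real n + 2)) < k"
      by (auto simp: eventually_sequentially)
    from n k0 that b have "\<forall>\<^sub>F t::nat in sequentially.
        c + 2 * real t powr k0 + real t powr (b * (1 + 1 / (real n + 2))) \<le> real t powr k"
      by (intro eventually_powr_le_powr) auto
    with upper[of n] err show ?thesis
      by eventually_elim linarith
  qed
  show "filterlim v at_bot sequentially"
  proof (rule filterlim_at_bot_mono)
    show "filterlim (\<lambda>t. - (real t powr (b / 2))) at_bot sequentially"
      using b by real_asymp
    show "\<forall>\<^sub>F t in sequentially. v t \<le> - (real t powr (b / 2))"
      using low[of "b / 2"] b by (auto elim: eventually_mono)
  qed
  have abs_bounds: "k \<le> ln \<bar>v t\<bar> / ln (real t) \<longleftrightarrow> real t powr k \<le> - v t"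
      "ln \<bar>v t\<bar> / ln (real t) \<le> k \<longleftrightarrow> - v t \<le> real t powr k"
    if "1 < t" "v t < 0" for t k
  proof -
    have "ln (real t) > 0" using that by simp
    then show "k \<le> ln \<bar>v t\<bar> / ln (real t) \<longleftrightarrow> real t powr k \<le> - v t"
      "ln \<bar>v t\<bar> / ln (real t) \<le> k \<longleftrightarrow> - v t \<le> real t powr k"
      using that by (auto simp: pos_le_divide_eq pos_divide_le_eq powr_def ln_ge_iff
          ln_le_cancel_iff[of "- v t" "exp _", simplified, symmetric])
  qed
  have neg: "\<forall>\<^sub>F t in sequentially. v t < 0"
    using low[OF b] eventually_gt_at_top[of 0] by eventually_elim auto
  show "(\<lambda>t. ln \<bar>v t\<bar> / ln (real t)) \<longlonglongrightarrow> b"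
  proof (rule order_tendstoI)
    fix k assume "k < b"
    then have "(k + b) / 2 < b" by simp
    from low[OF this] neg eventually_gt_at_top[of 1]
    show "\<forall>\<^sub>F t in sequentially. k < ln \<bar>v t\<bar> / ln (real t)"
    proof eventually_elim
      case (elim t)
      then have "(k + b) / 2 \<le> ln \<bar>v t\<bar> / ln (real t)"
        using abs_bounds(1)[of t "(k + b) / 2"] by blast
      then show ?case
        by (rule less_le_trans[rotated]) (use \<open>k < b\<close> in simp)
    qed
  next
    fix k assume "b < k"
    then have "b < (k + b) / 2" by simp
    from up[OF this] neg eventually_gt_at_top[of 1]
    show "\<forall>\<^sub>F t in sequentially. ln \<bar>v t\<bar> / ln (real t) < k"
    proof eventually_elim
      case (elim t)
      then have "ln \<bar>v t\<bar> / ln (real t) \<le> (k + b) / 2"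
        using abs_bounds(2)[of t "(k + b) / 2"] by blast
      then show ?case
        by (rule le_less_trans) (use \<open>b < k\<close> in simp)
    qed
  qed
qed

section \<open>Growth of the increments by line and sign\<close>

lemma T_neg_bounds:
  assumes "uniform_limit L (\<lambda>x l. ln (T_neg \<phi> l x) / ln x) (\<lambda>_. - \<beta>) at_top"
    and "0 < \<epsilon>" "\<epsilon> \<le> \<beta>"
  shows "\<forall>\<^sub>F x in at_top. \<forall>l\<in>L. x powr (- \<beta> - \<epsilon>) \<le> T_neg \<phi> l x \<and> T_neg \<phi> l x \<le> x powr (- \<beta> + \<epsilon>)"
  using uniform_limitD[OF assms(1,2)] eventually_gt_at_top[of 1]
proof eventually_elim
  case (elim x)
  then show ?case
    using powr_bounds_of_ln_ratio[of x "T_neg \<phi> _ x" \<epsilon> \<beta>] assms(3)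
    by (auto simp: T_neg_def)
qed

lemma T_neg_eq: "T_neg \<phi> l x = measure_pmf.prob (\<phi> l) {z. neg_part (of_int (snd z)) > x}"
  by (simp add: T_neg_def split_def)

text \<open>
  A single jump does it. At each step from a line other than 0 a downward jump beyond \<open>t powr \<kappa>\<close> has
  probability at least \<open>t powr (- \<kappa> * (\<beta> + \<epsilon>))\<close>. As \<open>\<kappa> < 1 / \<beta>\<close>, this exponent exceeds \<open>- 1\<close> for small
  \<open>\<epsilon>\<close>, so in at least \<open>t / 2\<close> trials the probability of seeing no such jump is at most
  \<open>exp (- (t powr \<eta>) / 2)\<close> with \<open>\<eta> > 0\<close>, which is summable.
\<close>
lemma AE_eventually_powr_le_neg_sum:
  assumes mc: "markov_chain M (A \<times> UNIV) (strip_kernel \<phi>) (\<lambda>t \<omega>. (U t \<omega>, V t \<omega>))"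
    and lim: "uniform_limit (A - {0}) (\<lambda>x l. ln (T_neg \<phi> l x) / ln x) (\<lambda>_. - \<beta>) at_top"
    and \<beta>: "0 < \<beta>" and \<kappa>: "0 < \<kappa>" "\<kappa> < 1 / \<beta>"
    and sparse: "AE \<omega> in M. \<forall>\<^sub>F t in sequentially. 2 * (\<Sum>s<t. indicator {0} (U s \<omega>)) \<le> real t"
  shows "AE \<omega> in M. \<forall>\<^sub>F t in sequentially. real t powr \<kappa> \<le>
    (\<Sum>s<t. indicator (- {0}) (U s \<omega>) * neg_part (of_int (incr V s \<omega>)))"
proof -
  \<comment> \<open>Small enough for \<open>\<kappa> * (\<beta> + \<epsilon>) < 1\<close>, which makes \<open>\<eta>\<close> below positive.\<close>
  define \<epsilon> where "\<epsilon> = min \<beta> ((1 / \<kappa> - \<beta>) / 2)"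
  have "\<beta> < 1 / \<kappa>" using \<beta> \<kappa> by (simp add: field_simps)
  then have \<epsilon>: "0 < \<epsilon>" "\<epsilon> \<le> \<beta>" "\<beta> + \<epsilon> < 1 / \<kappa>" using \<beta> by (auto simp: \<epsilon>_def min_def field_simps)
  define \<eta> where "\<eta> = 1 - \<kappa> * (\<beta> + \<epsilon>)"
  have "0 < \<eta>" using \<epsilon> \<kappa> by (simp add: \<eta>_def field_simps)
  define p where "p t = real t powr (\<kappa> * (- \<beta> - \<epsilon>))" for t
  define J :: "nat \<Rightarrow> nat \<times> int \<Rightarrow> nat \<times> int \<Rightarrow> bool"
    where "J t x z \<longleftrightarrow> neg_part (of_int (snd z - snd x)) > real t powr \<kappa>" for t x z
  have prob_J: "measure_pmf.prob (strip_kernel \<phi> x) {z. J t x z} = T_neg \<phi> (fst x) (real t powr \<kappa>)" for t x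
    by (simp add: J_def T_neg_eq strip_kernel_def split_def vimage_def)
  have "filterlim (\<lambda>t::nat. real t powr \<kappa>) at_top sequentially"
    using \<kappa>(1) by real_asymp
  from eventually_compose_filterlim[OF T_neg_bounds[OF lim \<epsilon>(1,2)] this]
  have p: "\<forall>\<^sub>F t in sequentially. 0 \<le> p t \<and> (\<forall>x\<in>(A \<times> UNIV) \<inter> ((- {0}) \<times> UNIV).
      p t \<le> measure_pmf.prob (strip_kernel \<phi> x) {z. J t x z})"
    by eventually_elim (auto simp: prob_J p_def powr_powr)
  have "\<forall>\<^sub>F t in sequentially. exp (- (real t powr \<eta> / 2)) = exp (- (p t * real t / 2))"
    using eventually_gt_at_top[of 0]
  proof eventually_elim
    case (elim t)
    have "p t * real t = real t powr (\<kappa> * (- \<beta> - \<epsilon>) + 1)"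
      using elim by (simp add: p_def powr_add)
    then show ?case by (simp add: \<eta>_def algebra_simps)
  qed
  with summable_exp_minus_powr[OF \<open>0 < \<eta>\<close>] have sum: "summable (\<lambda>t. exp (- (p t * real t / 2)))"
    by (simp add: summable_cong)
  have "AE \<omega> in M. \<forall>\<^sub>F t in sequentially. \<exists>s<t. (U s \<omega>, V s \<omega>) \<in> (- {0}) \<times> UNIV \<and>
      J t (U s \<omega>, V s \<omega>) (U (Suc s) \<omega>, V (Suc s) \<omega>)"
  proof (rule AE_eventually_jump[OF mc p sum])
    have "indicator (- ((- {0}) \<times> UNIV)) (U s \<omega>, V s \<omega>) = (indicator {0} (U s \<omega>) :: real)" for s \<omega>
      by (auto simp: indicator_def)
    with sparse show "AE \<omega> in M. \<forall>\<^sub>F t in sequentially.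
        2 * (\<Sum>s<t. indicator (- ((- {0}) \<times> UNIV)) (U s \<omega>, V s \<omega>)) \<le> real t"
      by simp
  qed
  then show ?thesis
  proof eventually_elim
    case (elim \<omega>)
    then show ?case
    proof eventually_elim
      case (elim t)
      then obtain s where s: "s < t" "U s \<omega> \<noteq> 0" "neg_part (of_int (incr V s \<omega>)) > real t powr \<kappa>"
        by (auto simp: J_def)
      then have "real t powr \<kappa> \<le> indicator (- {0}) (U s \<omega>) * neg_part (of_int (incr V s \<omega>))"
        by simp
      also have "\<dots> \<le> (\<Sum>s<t. indicator (- {0}) (U s \<omega>) * neg_part (of_int (incr V s \<omega>)))"
        using s(1) by (intro member_le_sum) auto
      finally show ?case .
    qed
  qed
qed

lemma AE_off_zero_sum_le_powr:
  fixes f :: "real \<Rightarrow> real" and c :: ennreal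
  assumes mc: "markov_chain M (A \<times> UNIV) (strip_kernel \<phi>) (\<lambda>t \<omega>. (U t \<omega>, V t \<omega>))"
    and f: "\<And>x. 0 \<le> f x" and a: "0 < a" "a \<le> 1" "1 / a < \<kappa>" and c: "c < \<infinity>"
    and moment: "\<And>l. l \<in> A - {0} \<Longrightarrow>
      (\<integral>\<^sup>+z. ennreal (f (of_int (snd z)) powr a) \<partial>measure_pmf (\<phi> l)) \<le> c"
  shows "AE \<omega> in M. \<forall>\<^sub>F t in sequentially.
    (\<Sum>s<t. indicator (- {0}) (U s \<omega>) * f (of_int (incr V s \<omega>))) \<le> real t powr \<kappa>"
proof -
  interpret prob_space M using mc by (simp add: markov_chain_def)
  show ?thesis
  proof (rule AE_strip_sum_le_powr[OF mc _ a(1,2) _ a(3) c,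
      where f="\<lambda>l d. indicator (- {0}) l * f (of_int d)" and g="\<lambda>_. 1"])
    show "(\<integral>\<^sup>+z. ennreal ((indicator (- {0}) l * f (of_int (snd z))) powr a) \<partial>measure_pmf (\<phi> l)) \<le>
        c * ennreal 1" if "l \<in> A" for l
      using moment[of l] that by (cases "l = 0") auto
  qed (auto simp: f emeasure_space_1 ennreal_of_nat_eq_real_of_nat eventually_sequentially)
qed

text \<open>
  Only about \<open>t powr \<gamma>\<close> increments have been collected on the line 0 by time \<open>t\<close>, so a moment of order
  \<open>a\<close> bounds their sum by \<open>t powr \<kappa>\<close> for every \<open>\<kappa> > \<gamma> / a\<close>. With \<open>f = 1\<close> and \<open>a = 1\<close> it bounds the number
  of visits itself.
\<close>
lemma AE_zero_line_sum_le_powr: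
  fixes f :: "real \<Rightarrow> real" and c :: ennreal
  assumes A: "0 \<in> A"
    and mc: "markov_chain M (A \<times> UNIV) (strip_kernel \<phi>) (\<lambda>t \<omega>. (U t \<omega>, V t \<omega>))"
    and \<gamma>: "0 < \<gamma>"
    and tail: "(\<lambda>t::nat. ln (\<P>(\<omega> in markov_law (induced_kernel \<phi>) 0. return_time 0 \<omega> > enat t)) / ln (real t))
           \<longlonglongrightarrow> - \<gamma>"
    and f: "\<And>x. 0 \<le> f x" and a: "0 < a" "a \<le> 1" and \<kappa>: "\<gamma> / a < \<kappa>" and c: "c < \<infinity>"
    and moment: "(\<integral>\<^sup>+z. ennreal (f (of_int (snd z)) powr a) \<partial>measure_pmf (\<phi> 0)) \<le> c"
  shows "AE \<omega> in M. \<forall>\<^sub>F t in sequentially.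
    (\<Sum>s<t. indicator {0} (U s \<omega>) * f (of_int (incr V s \<omega>))) \<le> real t powr \<kappa>"
proof -
  from \<kappa> a obtain b where b: "\<gamma> < b" "b < \<kappa> * a"
    using dense[of \<gamma> "\<kappa> * a"] by (auto simp: field_simps)
  then have b': "0 \<le> b" "b / a < \<kappa>" using a \<gamma> by (auto simp: field_simps)
  show ?thesis
  proof (rule AE_strip_sum_le_powr[OF mc _ a b' c _ expected_visits_powr[OF A mc \<gamma> b(1) tail],
      where f="\<lambda>l d. indicator {0} l * f (of_int d)"])
    show "(\<integral>\<^sup>+z. ennreal ((indicator {0} l * f (of_int (snd z))) powr a) \<partial>measure_pmf (\<phi> l)) \<le>
        c * ennreal (indicator {0} l)" for l
      using moment by (cases "l = 0") auto
  qed (simp add: f)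
qed

section \<open>Direction and growth exponent of the vertical coordinate\<close>

theorem theorem3p3:
  fixes A :: "nat set"
    and \<phi> :: "nat \<Rightarrow> (nat \<times> int) pmf"
    and M :: "'w measure"
    and U :: "nat \<Rightarrow> 'w \<Rightarrow> nat"
    and V :: "nat \<Rightarrow> 'w \<Rightarrow> int"
    and \<alpha> \<beta> \<gamma> \<delta> :: real
    and C :: ennreal
  assumes "line_set A"
    and "strip_transitions A \<phi>"
    and "markov_chain M (A \<times> UNIV) (strip_kernel \<phi>) (\<lambda>t \<omega>. (U t \<omega>, V t \<omega>))"
    and "irreducible_chain A (induced_kernel \<phi>)"
    and "null_recurrent_chain A (induced_kernel \<phi>)"
    and "0 < \<gamma>" "\<gamma> < 1"
    and "(\<lambda>t::nat. ln (\<P>(\<omega> in markov_law (induced_kernel \<phi>) 0. return_time 0 \<omega> > enat t)) / ln (real t))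
           \<longlonglongrightarrow> - \<gamma>"
    and "0 < \<alpha>" "\<alpha> < 1"
    and "0 < \<beta>" "\<beta> < 1"
    and "\<delta> > 0"
    and "C < \<infinity>"
    and "M_pos \<phi> 0 \<alpha> + M_neg \<phi> 0 \<alpha> \<le> C"
    and "uniform_limit (A - {0}) (\<lambda>x l. ln (T_neg \<phi> l x) / ln x) (\<lambda>_. - \<beta>) at_top"
    and "\<forall>l\<in>A - {0}. M_pos \<phi> l (\<beta> + \<delta>) \<le> C"
    and "\<alpha> > \<gamma> * \<beta>"
  shows "(AE \<omega> in M. filterlim (\<lambda>t. V t \<omega>) at_bot sequentially) \<and>
         (AE \<omega> in M. (\<lambda>t::nat. ln \<bar>real_of_int (V t \<omega>)\<bar> / ln (real t)) \<longlonglongrightarrow> 1 / \<beta>)"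
proof -
  note mc = assms(3) and tail = assms(8) and lim = assms(16)
  have A0: "0 \<in> A" using assms(1) by (auto simp: line_set_def)
  define G where "G t \<omega> = (\<Sum>s<t. indicator (- {0}) (U s \<omega>) * neg_part (of_int (incr V s \<omega>)))" for t \<omega>
  define P where "P t \<omega> = (\<Sum>s<t. indicator (- {0}) (U s \<omega>) * pos_part (of_int (incr V s \<omega>)))" for t \<omega>
  define Z where "Z t \<omega> = (\<Sum>s<t. indicator {0} (U s \<omega>) * \<bar>of_int (incr V s \<omega>)\<bar> :: real)" for t \<omega>
  \<comment> \<open>Subadditivity of powers needs an order of at most 1.\<close>
  define a where "a = min 1 (\<beta> + \<delta>)"
  have a: "0 < a" "a \<le> 1" "\<beta> < a" using assms by (auto simp: a_def)
  have "max (\<gamma> / \<alpha>) (1 / a) < 1 / \<beta>"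
    using assms a by (simp add: field_simps)
  \<comment> \<open>The hypothesis \<open>\<gamma> * \<beta> < \<alpha>\<close> makes the line 0, and \<open>\<delta> > 0\<close> the upward steps,
    negligible against \<open>t powr (1 / \<beta>)\<close>; \<open>\<kappa>0\<close> is an exponent witnessing both.\<close>
  then obtain \<kappa>0 where "max (\<gamma> / \<alpha>) (1 / a) < \<kappa>0" and \<kappa>0: "\<kappa>0 < 1 / \<beta>"
    using dense by blast
  then have \<kappa>0': "\<gamma> / \<alpha> < \<kappa>0" "1 / a < \<kappa>0" by auto

  have P: "AE \<omega> in M. \<forall>\<^sub>F t in sequentially. P t \<omega> \<le> real t powr \<kappa>0"
    unfolding P_def
  proof (rule AE_off_zero_sum_le_powr[OF mc _ a(1,2) \<kappa>0'(2) assms(14)])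
    fix l assume l: "l \<in> A - {0}"
    \<comment> \<open>Lowering the order of the moment is free since a nonzero increment is at least 1 in size.\<close>
    have "pos_part (of_int d) powr a \<le> pos_part (of_int d) powr (\<beta> + \<delta>)" for d
      by (cases "d > 0") (auto simp: pos_part_def a_def intro!: powr_mono)
    then have "(\<integral>\<^sup>+z. ennreal (pos_part (of_int (snd z)) powr a) \<partial>measure_pmf (\<phi> l)) \<le> M_pos \<phi> l (\<beta> + \<delta>)"
      unfolding M_pos_def split_def by (intro nn_integral_mono ennreal_leI)
    with assms(17) l show "(\<integral>\<^sup>+z. ennreal (pos_part (of_int (snd z)) powr a) \<partial>measure_pmf (\<phi> l)) \<le> C"
      by (blast intro: order.trans)
  qed simp

  have Z: "AE \<omega> in M. \<forall>\<^sub>F t in sequentially. Z t \<omega> \<le> real t powr \<kappa>0"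
    unfolding Z_def
  proof (rule AE_zero_line_sum_le_powr[OF A0 mc assms(6) tail _ assms(9) _ \<kappa>0'(1) assms(14)])
    have "ennreal (\<bar>of_int d\<bar> powr \<alpha>) = ennreal (pos_part (of_int d) powr \<alpha>) + ennreal (neg_part (of_int d) powr \<alpha>)" for d
      by (auto simp: pos_part_def neg_part_def indicator_def)
    then have "(\<integral>\<^sup>+z. ennreal (\<bar>of_int (snd z)\<bar> powr \<alpha>) \<partial>measure_pmf (\<phi> 0)) = M_pos \<phi> 0 \<alpha> + M_neg \<phi> 0 \<alpha>"
      by (simp add: M_pos_def M_neg_def split_def nn_integral_add)
    with assms(15) show "(\<integral>\<^sup>+z. ennreal (\<bar>of_int (snd z)\<bar> powr \<alpha>) \<partial>measure_pmf (\<phi> 0)) \<le> C"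
      by simp
  qed (use assms(10) in auto)

  have G_upper: "AE \<omega> in M. \<forall>\<^sub>F t in sequentially. G t \<omega> \<le> real t powr \<kappa>" if \<kappa>: "1 / \<beta> < \<kappa>" for \<kappa>
  proof -
    have "0 < \<kappa>" using \<kappa> assms(11) by (meson less_trans zero_less_divide_1_iff)
    then have "1 / \<kappa> < \<beta>" using \<kappa> assms(11) by (simp add: field_simps)
    then obtain e where e: "1 / \<kappa> < e" "e < \<beta>" using dense by blast
    have "0 < e" using e(1) \<open>0 < \<kappa>\<close> by (meson less_trans zero_less_divide_1_iff)
    have e': "1 / e < \<kappa>" using e(1) \<open>0 < e\<close> \<open>0 < \<kappa>\<close> by (simp add: field_simps)
    \<comment> \<open>Tail exponent \<open>b\<close> and moment order \<open>e\<close> with \<open>1 / \<kappa> < e < b < \<beta>\<close>.\<close>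
    define b where "b = (e + \<beta>) / 2"
    have b: "e < b" "0 < \<beta> - b" "\<beta> - b \<le> \<beta>" using e \<open>0 < e\<close> by (auto simp: b_def)
    have "filterlim (\<lambda>k::nat. (2::real) ^ k) at_top sequentially"
      by real_asymp
    from eventually_compose_filterlim[OF T_neg_bounds[OF lim b(2,3)] this]
    obtain k0 where k0: "\<And>k l. k0 \<le> k \<Longrightarrow> l \<in> A - {0} \<Longrightarrow> T_neg \<phi> l (2 ^ k) \<le> (2 ^ k) powr (- b)"
      by (auto simp: eventually_sequentially)
    show ?thesis
      unfolding G_def
    proof (rule AE_off_zero_sum_le_powr[OF mc _ \<open>0 < e\<close> _ e'])
      fix l assume l: "l \<in> A - {0}"
      show "(\<integral>\<^sup>+z. ennreal (neg_part (of_int (snd z)) powr e) \<partial>measure_pmf (\<phi> l)) \<le>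
          ennreal (1 + 2 powr e * (2 ^ k0) powr b / (1 - 2 powr (e - b)))"
        using k0[OF _ l] by (intro nn_integral_powr_le_of_dyadic_tail \<open>0 < e\<close> b) (auto simp: T_neg_eq)
    qed (use e assms(12) in auto)
  qed

  have sparse: "AE \<omega> in M. \<forall>\<^sub>F t in sequentially. 2 * (\<Sum>s<t. indicator {0} (U s \<omega>)) \<le> real t"
  proof -
    obtain \<kappa> where \<kappa>: "\<gamma> < \<kappa>" "\<kappa> < 1" using dense[OF assms(7)] by blast
    have "AE \<omega> in M. \<forall>\<^sub>F t in sequentially. (\<Sum>s<t. indicator {0} (U s \<omega>) * (1::real)) \<le> real t powr \<kappa>"
      using \<kappa> by (intro AE_zero_line_sum_le_powr[OF A0 mc assms(6) tail, where f="\<lambda>_. 1" and a=1 and c=1]) auto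
    then show ?thesis
    proof eventually_elim
      case (elim \<omega>)
      have "\<forall>\<^sub>F t::nat in sequentially. 0 + 2 * real t powr \<kappa> + real t powr 0 \<le> real t powr 1"
        using \<kappa> by (intro eventually_powr_le_powr) auto
      with elim show ?case
      proof eventually_elim
        case (elim t)
        then show ?case by (cases "t = 0") auto
      qed
    qed
  qed

  have lower: "AE \<omega> in M. \<forall>n::nat. \<forall>\<^sub>F t in sequentially. real t powr ((1 / \<beta>) * (1 - 1 / (real n + 2))) \<le> G t \<omega>"
    unfolding AE_all_countable G_def
  proof (intro allI AE_eventually_powr_le_neg_sum[OF mc lim assms(11) _ _ sparse])
    fix n :: nat
    have "1 / (real n + 2) < 1" by simp
    with assms(11) show "0 < 1 / \<beta> * (1 - 1 / (real n + 2))"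
      by (intro mult_pos_pos) auto
    have "1 / \<beta> * (1 - 1 / (real n + 2)) < 1 / \<beta> * 1"
      using assms(11) by (intro mult_strict_left_mono) auto
    then show "1 / \<beta> * (1 - 1 / (real n + 2)) < 1 / \<beta>" by simp
  qed
  have upper: "AE \<omega> in M. \<forall>n::nat. \<forall>\<^sub>F t in sequentially. G t \<omega> \<le> real t powr ((1 / \<beta>) * (1 + 1 / (real n + 2)))"
    unfolding AE_all_countable
  proof (intro allI G_upper)
    fix n :: nat
    have "1 / \<beta> * 1 < 1 / \<beta> * (1 + 1 / (real n + 2))"
      using assms(11) by (intro mult_strict_left_mono) auto
    then show "1 / \<beta> < 1 / \<beta> * (1 + 1 / (real n + 2))" by simp
  qed

  have decomp: "\<bar>real_of_int (V t \<omega>) + G t \<omega>\<bar> \<le> \<bar>real_of_int (V 0 \<omega>)\<bar> + P t \<omega> + Z t \<omega>" for t \<omega>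
  proof -
    have "real_of_int (V t \<omega>) = real_of_int (V 0 \<omega>) + (\<Sum>s<t. of_int (incr V s \<omega>))"
      by (induction t) auto
    also have "(\<Sum>s<t. real_of_int (incr V s \<omega>)) =
        P t \<omega> - G t \<omega> + (\<Sum>s<t. indicator {0} (U s \<omega>) * of_int (incr V s \<omega>))"
      unfolding P_def G_def sum_subtractf[symmetric] sum.distrib[symmetric]
      using pos_part_minus_neg_part by (intro sum.cong) (auto simp: indicator_def)
    finally have "real_of_int (V t \<omega>) + G t \<omega> = real_of_int (V 0 \<omega>) + P t \<omega> +
        (\<Sum>s<t. indicator {0} (U s \<omega>) * of_int (incr V s \<omega>))"
      by simp
    moreover have "0 \<le> P t \<omega>"
      unfolding P_def by (intro sum_nonneg) auto
    moreover have "\<bar>\<Sum>s<t. indicator {0} (U s \<omega>) * real_of_int (incr V s \<omega>)\<bar> \<le> Z t \<omega>"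
      unfolding Z_def by (rule order.trans[OF sum_abs]) (simp add: abs_mult)
    ultimately show ?thesis by linarith
  qed

  have "AE \<omega> in M. filterlim (\<lambda>t. real_of_int (V t \<omega>)) at_bot sequentially \<and>
      (\<lambda>t::nat. ln \<bar>real_of_int (V t \<omega>)\<bar> / ln (real t)) \<longlonglongrightarrow> 1 / \<beta>"
    using lower upper P Z
  proof eventually_elim
    case (elim \<omega>)
    have "\<forall>\<^sub>F t in sequentially. \<bar>real_of_int (V t \<omega>) + G t \<omega>\<bar> \<le> \<bar>real_of_int (V 0 \<omega>)\<bar> + 2 * real t powr \<kappa>0"
      using elim(3,4)
    proof eventually_elim
      case (elim t)
      then show ?case using decomp[of t \<omega>] by linarith
    qed
    from drift_asymptotics[OF _ \<kappa>0 _ _ this] elim(1,2) assms(11) show ?case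
      by auto
  qed
  moreover have "filterlim v at_bot sequentially"
    if "filterlim (\<lambda>t. real_of_int (v t)) at_bot sequentially" for v :: "nat \<Rightarrow> int"
    unfolding filterlim_at_bot
  proof
    fix z :: int
    have "\<forall>\<^sub>F t in sequentially. real_of_int (v t) \<le> real_of_int z"
      using that unfolding filterlim_at_bot by blast
    then show "\<forall>\<^sub>F t in sequentially. v t \<le> z" by simp
  qed
  ultimately show ?thesis
    by (auto elim: AE_mp)
qed

end
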